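(* Fix $\delta>0$ and $i\in\{0,1\}$, and let $Y=Y(X)$ satisfy $2\le Y\le X^{1/12-\delta}$. Let $$\mathcal P(Y)=\{(\alpha,\beta)\in\mathbb Z^2:\gcd(\alpha,\beta)=1,\ Y\le|\alpha|,|\beta|<2Y\},$$ and define $J_T^{(i)}(X;Y)=\sum_{P\in\mathcal P(Y)}N_{P,T}^{(i)}(X)$ and $J^{(i)}(X;Y)=\sum_{P\in\mathcal P(Y)}N_P^{(i)}(X)$. Then the family of pairs $(f,P)$ with $P\in\mathcal P(Y)$ exhibits averaged non-escape of mass, that is, $$\lim_{T\to\infty}\limsup_{X\to\infty}\frac{J_T^{(i)}(X;Y)}{J^{(i)}(X;Y)}=0 .$$
   Context: Forms and action: $V_{\mathbb R}$ is the space of real binary cubic forms $f(X,Y)=aX^3+bX^2Y+cXY^2+dY^3$, with $\mathrm{GL}_2(\mathbb R)$ acting by the twisted action $(g\cdot f)(X,Y)=\det(g)^{-1}f((X,Y)g)$, where $(X,Y)$ is a row vector. $\mathrm{Disc}(f)=b^2c^2-4ac^3-4b^3d-27a^2d^2+18abcd$. $V_{\mathbb R}^{(0)}$ (resp. $V_{\mathbb R}^{(1)}$) is the set of forms with $\mathrm{Disc}(f)>0$ (resp. $<0$); $V_{\mathbb Z}^{(i)}$ is the set of forms in $V_{\mathbb R}^{(i)}$ with integer coefficients $a,b,c,d$; $V_{\mathbb Z}^{(i),\mathrm{irr}}$ is the subset of forms irreducible over $\mathbb Q$. Fundamental domain: put $n(u)=\begin{pmatrix}1&0\\ u&1\end{pmatrix}$,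 $a(t)=\begin{pmatrix}t^{-1}&0\\0&t\end{pmatrix}$, $K=\mathrm{SO}_2(\mathbb R)$, $t_0=\sqrt[4]{3}/\sqrt2$; a scalar $\lambda>0$ stands for $\lambda I_2$. Gauss's usual fundamental domain for $\mathrm{GL}_2(\mathbb Z)\backslash\mathrm{GL}_2(\mathbb R)$ is $\mathcal F=\{n(u)a(t)k\lambda: u\in\nu(t),\ t\ge t_0,\ k\in K,\ \lambda>0\}$, where $\nu(t)\subset[-\frac12,\frac12]$ is a union of at most two intervals with $\nu(t)=[-\frac12,\frac12]$ for $t\ge1$ (explicitly, up to boundary, $\nu(t)=\{u\in[-\frac12,\frac12]:u^2+t^4\ge1\}$). For $T>t_0$, $\mathcal F_T=\{n(u)a(t)k\lambda\in\mathcal F:t>T\}$. Shape parameter: a real form $f=ax^3+bx^2y+cxy^2+dy^3$ of nonzero discriminant corresponds (Delone–Faddeev) to the cubic $\mathbb R$-algebra with basis $1,\omega,\theta$ and $\omega\theta=-ad$, $\omega^2=-ac+b\omega-a\theta$, $\theta^2=-bd+d\omega-c\theta$. If $\mathrm{Disc}(f)<0$ this algebra is $\mathbb R\oplus\mathbb C$; let $z_\omega,z_\theta$ be the images of $\omega,\theta$ in $(\mathbb R\oplus\mathbb C)/\mathbb R(1,1)\simeq\mathbb C$, with the complex embedding chosen so that $\Im(z_\theta/z_\omega)>0$, and $\tau_f=z_\theta/z_\omega$. If $\mathrm{Disc}(f)>0$, let $x^0=x-\mathrm{Tr}(x)/3$, $A_0=\mathrm{Tr}((\omega^0)^2)$,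 $B_0=\mathrm{Tr}(\omega^0\theta^0)$, $C_0=\mathrm{Tr}((\theta^0)^2)$, and $\tau_f=(B_0+\sqrt{-1}\sqrt{A_0C_0-B_0^2})/A_0$. For each $i\in\{0,1\}$ a base form $v^{(i)}\in V_{\mathbb R}^{(i)}$ with $\tau_{v^{(i)}}=\sqrt{-1}$ is fixed. Counts: $\mathcal Fv^{(i)}$ and $\mathcal F_Tv^{(i)}$ are multisets: a form $f$ is counted with multiplicity $\#\{g\in\mathcal F:g\cdot v^{(i)}=f\}$ (resp. $g\in\mathcal F_T$). Fix constants $0<c_-<c_+$. For primitive $P\in\mathbb Z^2$ define $N_P^{(i)}(X)=\#\{f\in\mathcal Fv^{(i)}\cap V_{\mathbb Z}^{(i),\mathrm{irr}}:f(P)=1,\ c_-X\le|\mathrm{Disc}(f)|<c_+X\}$ and $N_{P,T}^{(i)}(X)=\#\{f\in\mathcal F_Tv^{(i)}\cap V_{\mathbb Z}^{(i),\mathrm{irr}}:f(P)=1,\ c_-X\le|\mathrm{Disc}(f)|<c_+X\}$. *)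

theory Defs
  imports "HOL-Analysis.Analysis" "HOL-Computational_Algebra.Polynomial"
begin

section \<open>Binary cubic forms\<close>

text \<open>The quadruple \<open>(a, b, c, d)\<close> stands for \<open>a X^3 + b X^2 Y + c X Y^2 + d Y^3\<close>.\<close>

type_synonym 'a cubic_form = "'a \<times> 'a \<times> 'a \<times> 'a"

fun form_eval :: "'a::comm_ring_1 cubic_form \<Rightarrow> 'a \<Rightarrow> 'a \<Rightarrow> 'a" where
  "form_eval (a, b, c, d) x y = a * x^3 + b * x^2 * y + c * x * y^2 + d * y^3"

fun disc :: "'a::comm_ring_1 cubic_form \<Rightarrow> 'a" where
  "disc (a, b, c, d) =
     b^2 * c^2 - 4 * a * c^3 - 4 * b^3 * d - 27 * a^2 * d^2 + 18 * a * b * c * d"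

text \<open>The element of \<open>R[X][Y]\<close> given by a form; \<open>Y\<close> is the outer variable.\<close>

fun form_poly :: "'a::comm_ring_1 cubic_form \<Rightarrow> 'a poly poly" where
  "form_poly (a, b, c, d) = [: [:0, 0, 0, a:], [:0, 0, b:], [:0, c:], [:d:] :]"

lemma poly_form_poly: "poly (poly (form_poly f) [:y:]) x = form_eval f x y"
  by (cases f) (simp add: algebra_simps power2_eq_square power3_eq_cube)

definition V_real :: "nat \<Rightarrow> real cubic_form set" where
  "V_real i = {f. if i = 0 then disc f > 0 else disc f < 0}"

definition V_int_irr :: "nat \<Rightarrow> real cubic_form set" where
  "V_int_irr i = {f \<in> V_real i. \<exists>a b c d :: int.
      f = (of_int a, of_int b, of_int c, of_int d) \<and>
      irreducible (form_poly (of_int a, of_int b, of_int c, of_int d) :: rat poly poly)}"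

text \<open>The twisted action, written out on coefficients; see the lemma that follows.\<close>

fun act :: "real^2^2 \<Rightarrow> real cubic_form \<Rightarrow> real cubic_form" where
  "act g (a, b, c, d) =
    (let p = g$1$1; q = g$1$2; r = g$2$1; s = g$2$2 in
      ((a * p^3 + b * p^2 * q + c * p * q^2 + d * q^3) / det g,
       (3 * a * p^2 * r + b * (2 * p * r * q + p^2 * s)
          + c * (r * q^2 + 2 * p * q * s) + 3 * d * q^2 * s) / det g,
       (3 * a * p * r^2 + b * (r^2 * q + 2 * p * r * s)
          + c * (2 * r * q * s + p * s^2) + 3 * d * q * s^2) / det g,
       (a * r^3 + b * r^2 * s + c * r * s^2 + d * s^3) / det g))"

lemma form_eval_act:
  fixes g :: "real^2^2"
  defines "w x y \<equiv> vector [x, y] v* g"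
  shows "form_eval (act g f) x y = inverse (det g) * form_eval f (w x y $ 1) (w x y $ 2)"
proof (cases f)
  case (fields a b c d)
  have "w x y $ 1 = x * g$1$1 + y * g$2$1" "w x y $ 2 = x * g$1$2 + y * g$2$2"
    by (simp_all add: w_def vector_matrix_mult_def sum_2 vector_2 mult.commute)
  then show ?thesis
    unfolding fields by (cases "det g = 0")
      (simp_all add: Let_def field_simps power2_eq_square power3_eq_cube)
qed

section \<open>Gauss's fundamental domain\<close>

definition n_mat :: "real \<Rightarrow> real^2^2" where
  "n_mat u = vector [vector [1, 0], vector [u, 1]]"

definition a_mat :: "real \<Rightarrow> real^2^2" where
  "a_mat t = vector [vector [inverse t, 0], vector [0, t]]"

definition SO2 :: "(real^2^2) set" where
  "SO2 = {k. orthogonal_matrix k \<and> det k = 1}"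

definition t0 :: real where
  "t0 = root 4 3 / sqrt 2"

definition nu_closed :: "real \<Rightarrow> real set" where
  "nu_closed t = {u \<in> {-1/2..1/2}. u^2 + t^4 \<ge> 1}"

text \<open>The section \<open>\<nu>(t)\<close> is only prescribed up to boundary points, so it is kept as a parameter.\<close>

definition gauss_nu :: "(real \<Rightarrow> real set) \<Rightarrow> bool" where
  "gauss_nu \<nu> \<longleftrightarrow>
     (\<forall>t\<ge>t0. (\<exists>I J. is_interval I \<and> is_interval J \<and> \<nu> t = I \<union> J) \<and>
        interior (nu_closed t) \<subseteq> \<nu> t \<and> \<nu> t \<subseteq> nu_closed t) \<and>
     (\<forall>t\<ge>1. \<nu> t = {-1/2..1/2})"

definition fund_dom :: "(real \<Rightarrow> real set) \<Rightarrow> (real^2^2) set" where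
  "fund_dom \<nu> = {n_mat u ** a_mat t ** k ** mat l | u t k l.
      u \<in> \<nu> t \<and> t \<ge> t0 \<and> k \<in> SO2 \<and> l > 0}"

definition fund_dom_cusp :: "(real \<Rightarrow> real set) \<Rightarrow> real \<Rightarrow> (real^2^2) set" where
  "fund_dom_cusp \<nu> T = {n_mat u ** a_mat t ** k ** mat l | u t k l.
      u \<in> \<nu> t \<and> t \<ge> t0 \<and> k \<in> SO2 \<and> l > 0 \<and> t > T}"

section \<open>The shape parameter\<close>

text \<open>The Delone--Faddeev algebra of a form: \<open>real^3\<close> in the basis \<open>1, \<omega>, \<theta>\<close>, with
  \<open>\<omega>\<^sup>2 = -ac + b\<omega> - a\<theta>\<close>, \<open>\<omega>\<theta> = -ad\<close>, \<open>\<theta>\<^sup>2 = -bd + d\<omega> - c\<theta>\<close>.\<close>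

definition df_one :: "real^3" where "df_one = vector [1, 0, 0]"
definition df_omega :: "real^3" where "df_omega = vector [0, 1, 0]"
definition df_theta :: "real^3" where "df_theta = vector [0, 0, 1]"

fun df_mult :: "real cubic_form \<Rightarrow> real^3 \<Rightarrow> real^3 \<Rightarrow> real^3" where
  "df_mult (a, b, c, d) x y =
     vector [x$1 * y$1, x$1 * y$2 + x$2 * y$1, x$1 * y$3 + x$3 * y$1]
     + (x$2 * y$2) *\<^sub>R vector [- a * c, b, - a]
     + (x$2 * y$3 + x$3 * y$2) *\<^sub>R vector [- a * d, 0, 0]
     + (x$3 * y$3) *\<^sub>R vector [- b * d, d, - c]"

definition df_trace :: "real cubic_form \<Rightarrow> real^3 \<Rightarrow> real" where
  "df_trace f x = trace (matrix (df_mult f x))"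

definition df_traceless :: "real cubic_form \<Rightarrow> real^3 \<Rightarrow> real^3" where
  "df_traceless f x = x - (df_trace f x / 3) *\<^sub>R df_one"

text \<open>\<open>x \<mapsto> (\<rho> x, \<sigma> x)\<close> is an isomorphism of \<open>\<real>\<close>-algebras onto \<open>\<real> \<oplus> \<complex>\<close>.\<close>

definition df_iso :: "real cubic_form \<Rightarrow> (real^3 \<Rightarrow> real) \<Rightarrow> (real^3 \<Rightarrow> complex) \<Rightarrow> bool" where
  "df_iso f \<rho> \<sigma> \<longleftrightarrow>
     linear \<rho> \<and> linear \<sigma> \<and> \<rho> df_one = 1 \<and> \<sigma> df_one = 1 \<and>
     (\<forall>x y. \<rho> (df_mult f x y) = \<rho> x * \<rho> y \<and> \<sigma> (df_mult f x y) = \<sigma> x * \<sigma> y) \<and>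
     bij (\<lambda>x. (\<rho> x, \<sigma> x))"

text \<open>For negative discriminant, \<open>(\<real> \<oplus> \<complex>) / \<real>(1,1)\<close> is identified with \<open>\<complex>\<close> through
  \<open>(r, z) \<mapsto> z - r\<close>; the two isomorphisms differ by complex conjugation.\<close>

definition tau_neg :: "real cubic_form \<Rightarrow> complex" where
  "tau_neg f = (THE \<tau>. \<exists>\<rho> \<sigma>. df_iso f \<rho> \<sigma> \<and> Im \<tau> > 0 \<and>
     \<tau> = (\<sigma> df_theta - of_real (\<rho> df_theta)) / (\<sigma> df_omega - of_real (\<rho> df_omega)))"

definition tau_pos :: "real cubic_form \<Rightarrow> complex" where
  "tau_pos f =
    (let w = df_traceless f df_omega; h = df_traceless f df_theta;
         A = df_trace f (df_mult f w w);
         B = df_trace f (df_mult f w h);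
         C = df_trace f (df_mult f h h)
     in (of_real B + \<i> * of_real (sqrt (A * C - B^2))) / of_real A)"

definition tau :: "real cubic_form \<Rightarrow> complex" where
  "tau f = (if disc f > 0 then tau_pos f else tau_neg f)"

section \<open>Counting functions\<close>

text \<open>The multiset \<open>G v\<close> is counted with multiplicity. The index set is finite for
  \<open>G = fund_dom \<nu>\<close>: an irreducible integral form has nonzero \<open>X^3\<close>-coefficient, which bounds
  \<open>t\<close>, and the discriminant bounds \<open>\<lambda>\<close>. Stabilizers are finite as well, so neither the
  sum nor the cardinality takes its default value.\<close>

definition N_count ::
  "(real^2^2) set \<Rightarrow> real cubic_form \<Rightarrow> nat \<Rightarrow> real \<Rightarrow> real \<Rightarrow> int \<times> int \<Rightarrow> real \<Rightarrow> nat" where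
  "N_count G v i c_lo c_hi P X =
    (\<Sum>f \<in> {f \<in> (\<lambda>g. act g v) ` G \<inter> V_int_irr i.
              form_eval f (of_int (fst P)) (of_int (snd P)) = 1 \<and>
              c_lo * X \<le> \<bar>disc f\<bar> \<and> \<bar>disc f\<bar> < c_hi * X}.
       card {g \<in> G. act g v = f})"

definition prim_points :: "real \<Rightarrow> (int \<times> int) set" where
  "prim_points Y = {(\<alpha>, \<beta>). coprime \<alpha> \<beta> \<and>
     Y \<le> \<bar>of_int \<alpha>\<bar> \<and> \<bar>of_int \<alpha>\<bar> < 2 * Y \<and> Y \<le> \<bar>of_int \<beta>\<bar> \<and> \<bar>of_int \<beta>\<bar> < 2 * Y}"

definition J_count ::
  "(real^2^2) set \<Rightarrow> real cubic_form \<Rightarrow> nat \<Rightarrow> real \<Rightarrow> real \<Rightarrow> real \<Rightarrow> real \<Rightarrow> nat" where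
  "J_count G v i c_lo c_hi Y X = (\<Sum>P \<in> prim_points Y. N_count G v i c_lo c_hi P X)"

section \<open>The hypotheses on base forms and on \<open>\<nu>\<close> can be met\<close>

lemma df_iso_example:
  assumes "df_iso (0, 1, 0, 1) \<rho> \<sigma>"
  shows "\<rho> df_omega = 1 \<and> \<rho> df_theta = 0 \<and> \<sigma> df_omega = 0 \<and> (\<sigma> df_theta)^2 = -1"
proof -
  let ?f = "(0, 1, 0, 1) :: real cubic_form"
  have lin: "linear \<rho>" "linear \<sigma>" and one: "\<rho> df_one = 1" "\<sigma> df_one = 1"
    and mult: "\<And>x y. \<rho> (df_mult ?f x y) = \<rho> x * \<rho> y" "\<And>x y. \<sigma> (df_mult ?f x y) = \<sigma> x * \<sigma> y"
    and inj: "inj (\<lambda>x. (\<rho> x, \<sigma> x))"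
    using assms by (auto simp: df_iso_def bij_def)
  have m: "df_mult ?f df_omega df_omega = df_omega"
          "df_mult ?f df_theta df_theta = df_omega - df_one"
          "df_mult ?f df_omega df_theta = 0"
    by (simp_all add: df_one_def df_omega_def df_theta_def vec_eq_iff forall_3 vector_3)
  have r: "\<rho> df_omega * \<rho> df_omega = \<rho> df_omega" "\<rho> df_theta * \<rho> df_theta = \<rho> df_omega - 1"
    "\<rho> df_omega * \<rho> df_theta = 0"
    using mult(1) m one(1) linear_diff[OF lin(1)] linear_0[OF lin(1)] by metis+
  have s: "\<sigma> df_omega * \<sigma> df_omega = \<sigma> df_omega" "\<sigma> df_theta * \<sigma> df_theta = \<sigma> df_omega - 1"
    "\<sigma> df_omega * \<sigma> df_theta = 0"
    using mult(2) m one(2) linear_diff[OF lin(2)] linear_0[OF lin(2)] by metis+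
  have "\<rho> df_omega = 0 \<or> \<rho> df_omega = 1" using r(1) by simp
  moreover have "\<rho> df_omega \<noteq> 0"
    using r(2) zero_le_square[of "\<rho> df_theta"] by auto
  ultimately have r1: "\<rho> df_omega = 1" by simp
  have "\<sigma> df_omega = 0 \<or> \<sigma> df_omega = 1" using s(1) by simp
  moreover have "\<sigma> df_omega \<noteq> 1"
  proof
    assume "\<sigma> df_omega = 1"
    then have "df_omega = df_one" using injD[OF inj, of df_omega df_one] r1 one by simp
    then show False by (simp add: df_one_def df_omega_def vec_eq_iff forall_3 vector_3)
  qed
  ultimately show ?thesis using r r1 s by (auto simp: power2_eq_square)
qed

lemma base_form_pos: "(1, 0, -3, 0) \<in> V_real 0" "tau (1, 0, -3, 0) = \<i>"
  by (simp_all add: V_real_def tau_def tau_pos_def df_traceless_def df_trace_def trace_def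
      matrix_def sum_3 df_one_def df_omega_def df_theta_def vector_3 axis_def Let_def
      power2_eq_square)

lemma base_form_neg: "(0, 1, 0, 1) \<in> V_real 1" "tau (0, 1, 0, 1) = \<i>"
proof -
  let ?f = "(0, 1, 0, 1) :: real cubic_form"
  define \<rho> :: "real^3 \<Rightarrow> real" where "\<rho> = (\<lambda>x. x$1 + x$2)"
  define \<sigma> :: "real^3 \<Rightarrow> complex" where "\<sigma> = (\<lambda>x. Complex (x$1) (- x$3))"
  have "bij (\<lambda>x. (\<rho> x, \<sigma> x))"
    by (rule bij_betw_byWitness
        [where f' = "\<lambda>(r, z). vector [Re z, r - Re z, - Im z] :: real^3"])
      (auto simp: \<rho>_def \<sigma>_def vec_eq_iff forall_3 vector_3)
  then have iso: "df_iso ?f \<rho> \<sigma>"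
    unfolding df_iso_def
    by (auto simp: \<rho>_def \<sigma>_def df_one_def vector_3 complex_eq_iff algebra_simps intro!: linearI)
  have "tau_neg ?f = \<i>"
    unfolding tau_neg_def
  proof (rule the_equality)
    have "\<sigma> df_theta = - \<i>" "\<rho> df_theta = 0" "\<sigma> df_omega = 0" "\<rho> df_omega = 1"
      by (simp_all add: \<rho>_def \<sigma>_def df_omega_def df_theta_def vector_3 complex_eq_iff)
    with iso show "\<exists>\<rho> \<sigma>. df_iso ?f \<rho> \<sigma> \<and> Im \<i> > 0 \<and>
      \<i> = (\<sigma> df_theta - of_real (\<rho> df_theta)) / (\<sigma> df_omega - of_real (\<rho> df_omega))"
      by (intro exI[of _ \<rho>] exI[of _ \<sigma>]) simp
  next
    fix \<tau>
    assume "\<exists>\<rho> \<sigma>. df_iso ?f \<rho> \<sigma> \<and> Im \<tau> > 0 \<and>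
      \<tau> = (\<sigma> df_theta - of_real (\<rho> df_theta)) / (\<sigma> df_omega - of_real (\<rho> df_omega))"
    then obtain \<rho> \<sigma> where iso: "df_iso ?f \<rho> \<sigma>" and im: "Im \<tau> > 0" and
      \<tau>: "\<tau> = (\<sigma> df_theta - of_real (\<rho> df_theta)) / (\<sigma> df_omega - of_real (\<rho> df_omega))"
      by blast
    have "\<tau> = - \<sigma> df_theta" "(\<sigma> df_theta)^2 = \<i>^2"
      using df_iso_example[OF iso] \<tau> by simp_all
    then have "\<tau> = \<i> \<or> \<tau> = - \<i>" unfolding power2_eq_iff by auto
    then show "\<tau> = \<i>" using im by auto
  qed
  then show "(0, 1, 0, 1) \<in> V_real 1" "tau (0, 1, 0, 1) = \<i>"
    by (simp_all add: V_real_def tau_def)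
qed

lemma gauss_nu_nu_closed: "gauss_nu nu_closed"
  unfolding gauss_nu_def
proof (intro conjI allI impI)
  fix t :: real
  assume "t \<ge> t0"
  let ?m = "sqrt (1 - t^4)"
  show "\<exists>I J. is_interval I \<and> is_interval J \<and> nu_closed t = I \<union> J"
  proof (cases "t^4 \<le> 1")
    case True
    have eq: "u^2 + t^4 \<ge> 1 \<longleftrightarrow> u \<le> - ?m \<or> ?m \<le> u" for u
    proof -
      have "u^2 + t^4 \<ge> 1 \<longleftrightarrow> sqrt (1 - t^4) \<le> sqrt (u^2)"
        by (subst real_sqrt_le_iff) linarith
      also have "\<dots> \<longleftrightarrow> ?m \<le> \<bar>u\<bar>" by simp
      finally show ?thesis by auto
    qed
    have "nu_closed t = ({-1/2..1/2} \<inter> {..-?m}) \<union> ({-1/2..1/2} \<inter> {?m..})"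
      unfolding nu_closed_def
      by (rule set_eqI) (simp only: mem_Collect_eq Un_iff Int_iff atMost_iff atLeast_iff eq, blast)
    then show ?thesis
      by (intro exI[of _ "{-1/2..1/2} \<inter> {..-?m}"] exI[of _ "{-1/2..1/2} \<inter> {?m..}"])
        (simp add: is_interval_Int is_interval_cc is_interval_ci is_interval_ic)
  next
    case False
    then have "u^2 + t^4 \<ge> 1" for u using zero_le_power2[of u] by linarith
    then have "nu_closed t = {-1/2..1/2} \<union> {-1/2..1/2}" by (auto simp: nu_closed_def)
    then show ?thesis
      by (intro exI[of _ "{-1/2..1/2}"]) (simp add: is_interval_cc)
  qed
next
  fix t :: real
  assume "t \<ge> 1"
  then have "t^4 \<ge> 1" by simp
  then have "u^2 + t^4 \<ge> 1" for u using zero_le_power2[of u] by linarith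
  then show "nu_closed t = {-1/2..1/2}" by (auto simp: nu_closed_def)
qed (auto simp: interior_subset)

end

theory Submission
  imports Defs "HOL-Real_Asymp.Real_Asymp"
begin

text \<open>
  Everything is compared for a single point \<open>P = (\<alpha>, \<beta>)\<close>, uniformly in \<open>P\<close>. The forms with
  \<open>f(P) = 1\<close> are a translate of the lattice of forms \<open>(\<beta>x - \<alpha>y) q\<close>, \<open>q\<close> an integral quadratic
  form, which has a basis of vectors of length about \<open>Y\<close>.

  Upper bound: a form of discriminant \<open>O(X)\<close> in the orbit piece of height \<open>t\<close> has coefficients
  \<open>a, b, c\<close> bounded by \<open>L / t\<^sup>3\<close>, \<open>L / t\<close>, \<open>L t\<close> with \<open>L\<close> of order \<open>X\<^bsup>1/4\<^esup>\<close>. Irreducibility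
  gives \<open>a \<noteq> 0\<close>, hence \<open>t\<^sup>3 \<le> L\<close>. Cutting \<open>t > T\<close> into unit steps and counting each
  box coefficient by coefficient (each is confined to one class modulo \<open>\<beta>\<close>) gives
  \<open>O(L\<^sup>3 / Y\<^sup>3 (1 / T + Y / L\<^bsup>2/3\<^esup>))\<close> forms, each with multiplicity at most the order of the
  stabilizer of \<open>v\<close>.

  Lower bound: rotating \<open>v\<close>, one finds a form vanishing at \<open>P\<close> in the interior of the bounded part
  of the fundamental domain. Orbits being open, a ball of radius of order \<open>L\<close> around a multiple of it
  lies in \<open>\<F> v\<close>, and it contains at least \<open>const L\<^sup>3 / Y\<^sup>3\<close> integral forms with \<open>f(P) = 1\<close>
  that are congruent to \<open>x\<^sup>3 + x y\<^sup>2 + y\<^sup>3\<close> modulo 2. The latter has no zero modulo 2, so all these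
  forms are irreducible.
\<close>

section \<open>Forms and the twisted action\<close>

text \<open>A binary cubic form is determined by its values at four pairwise non-proportional
  vectors, so identities for the action can be checked on evaluations.\<close>

lemma form_eqI:
  fixes f g :: "real cubic_form"
  assumes "\<And>x y. form_eval f x y = form_eval g x y"
  shows "f = g"
proof -
  obtain a b c d a' b' c' d' where fg: "f = (a, b, c, d)" "g = (a', b', c', d')"
    by (cases f, cases g) auto
  show ?thesis
    using assms[of 1 0] assms[of 0 1] assms[of 1 1] assms[of 1 "-1"] by (simp add: fg)
qed

text \<open>Substitution into row vectors is a left action, since \<open>(w g) h = w (g h)\<close>.
  For singular matrices both sides are zero because \<open>inverse 0 = 0\<close>.\<close>

lemma act_act: "act g (act h f) = act (g ** h) f"
proof (rule form_eqI)
  fix x y :: real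
  have *: "vector [(vector [x, y] v* g) $ 1, (vector [x, y] v* g) $ 2] = (vector [x, y] v* g :: real^2)"
    by (simp add: vec_eq_iff forall_2)
  show "form_eval (act g (act h f)) x y = form_eval (act (g ** h) f) x y"
    by (simp add: form_eval_act * det_mul vector_matrix_mul_assoc)
qed

text \<open>Plain substitution multiplies the discriminant by the sixth power of the determinant;
  the twist divides by its fourth power, the discriminant being homogeneous of degree 4.\<close>

lemma disc_act:
  assumes "det g \<noteq> 0"
  shows "disc (act g f) = (det g)\<^sup>2 * disc f"
proof (cases f)
  case (fields a b c d)
  define D where "D = det g"
  have D: "D = g$1$1 * g$2$2 - g$1$2 * g$2$1" by (simp add: D_def det_2)
  have D0: "D \<noteq> 0" using assms by (simp add: D_def)
  have *: "disc (a'/D, b'/D, c'/D, d'/D) = disc (a',b',c',d') / D^4" for a' b' c' d' :: real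
    using D0 by (simp add: field_simps power2_eq_square power3_eq_cube power4_eq_xxxx)
  have **: "disc (a * p^3 + b * p^2 * q + c * p * q^2 + d * q^3,
       3 * a * p^2 * r + b * (2 * p * r * q + p^2 * s)
          + c * (r * q^2 + 2 * p * q * s) + 3 * d * q^2 * s,
       3 * a * p * r^2 + b * (r^2 * q + 2 * p * r * s)
          + c * (2 * r * q * s + p * s^2) + 3 * d * q * s^2,
       a * r^3 + b * r^2 * s + c * r * s^2 + d * s^3) = (p * s - q * r)^6 * disc (a,b,c,d)"
    for p q r s :: real
    unfolding disc.simps by algebra
  have "D^6 * z / D^4 = D\<^sup>2 * z" for z
    using D0 by (simp add: field_simps flip: power_add)
  then show ?thesis
    unfolding fields act.simps Let_def D_def[symmetric] * **
    by (simp only: D[symmetric])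
qed

lemma form_eval_scale: "form_eval (l *\<^sub>R f) x y = l * form_eval f x y" for f :: "real cubic_form"
  by (cases f) (simp add: algebra_simps)

lemma form_eval_diff: "form_eval (f - g) x y = form_eval f x y - form_eval g x y"
  by (cases f; cases g) (simp add: algebra_simps)

lemma act_scale: "act g (l *\<^sub>R f) = l *\<^sub>R act g f"
  by (cases f) (simp add: Let_def algebra_simps add_divide_distrib)

lemma act_add: "act g (f + f') = act g f + act g f'"
  by (cases f; cases f') (simp add: Let_def algebra_simps add_divide_distrib)

lemma act_diff: "act g (f - f') = act g f - act g f'"
  using act_add[of g f "(-1) *\<^sub>R f'"] act_scale[of g "-1" f'] by simp

section \<open>The factors n(u), a(t), k and the scalar\<close>

lemma mat_nth: "mat l $ i $ j = (if i = j then l else 0)"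
  by (simp add: mat_def)

text \<open>Substitution contributes \<open>l^3\<close> and the twist
  \<open>1 / l^2\<close>.\<close>

lemma act_mat: "act (mat l) f = l *\<^sub>R f"
  by (cases f) (cases "l = 0"; simp add: Let_def mat_nth det_2 field_simps power2_eq_square power3_eq_cube)

lemma det_n_mat [simp]: "det (n_mat u) = 1"
  by (simp add: n_mat_def det_2)

lemma det_a_mat [simp]: "t \<noteq> 0 \<Longrightarrow> det (a_mat t) = 1"
  by (simp add: a_mat_def det_2)

lemma det_mat_2: "det (mat l :: real^2^2) = l\<^sup>2"
  by (simp add: det_2 mat_nth power2_eq_square)

lemma det_SO2: "k \<in> SO2 \<Longrightarrow> det k = 1"
  by (simp add: SO2_def)

lemma SO2_iff: "k \<in> SO2 \<longleftrightarrow> k$2$1 = - (k$1$2) \<and> k$2$2 = k$1$1 \<and> (k$1$1)\<^sup>2 + (k$1$2)\<^sup>2 = 1"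
proof
  assume "k \<in> SO2"
  then have o: "transpose k ** k = mat 1" and d: "det k = 1"
    by (auto simp: SO2_def orthogonal_matrix_def)
  define p q r s where pq: "p = k$1$1" "q = k$1$2" "r = k$2$1" "s = k$2$2"
  have "p * p + r * r = 1" "p * q + r * s = 0" "q * q + s * s = 1"
    using o by (auto simp: vec_eq_iff forall_2 matrix_matrix_mult_def sum_2 transpose_def mat_nth pq)
  moreover have "p * s - q * r = 1" using d by (simp add: det_2 pq)
  ultimately have "r = - q" "s = p" "p^2 + q^2 = 1"
    by algebra+
  then show "k$2$1 = - (k$1$2) \<and> k$2$2 = k$1$1 \<and> (k$1$1)\<^sup>2 + (k$1$2)\<^sup>2 = 1"
    by (simp add: pq)
next
  assume "k$2$1 = - (k$1$2) \<and> k$2$2 = k$1$1 \<and> (k$1$1)\<^sup>2 + (k$1$2)\<^sup>2 = 1"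
  then show "k \<in> SO2"
    by (auto simp: SO2_def orthogonal_matrix_def vec_eq_iff forall_2 matrix_matrix_mult_def sum_2
        transpose_def mat_nth det_2 power2_eq_square algebra_simps)
qed

lemma SO2_entry_le:
  assumes "k \<in> SO2"
  shows "\<bar>k$i$j\<bar> \<le> 1"
proof -
  have *: "\<bar>x\<bar> \<le> 1 \<and> \<bar>y\<bar> \<le> 1" if "x\<^sup>2 + y\<^sup>2 = 1" for x y :: real
    using that zero_le_power2[of x] zero_le_power2[of y]
    unfolding abs_square_le_1[symmetric] by linarith
  have "\<forall>i j. \<bar>k$i$j\<bar> \<le> 1"
    using assms *[of "k$1$1" "k$1$2"] by (simp add: SO2_iff forall_2)
  then show ?thesis by blast
qed

lemma a_mat_nth [simp]: "a_mat t $ 1 $ 1 = inverse t" "a_mat t $ 1 $ 2 = 0"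
  "a_mat t $ 2 $ 1 = 0" "a_mat t $ 2 $ 2 = t"
  by (simp_all add: a_mat_def)

lemma n_mat_nth [simp]: "n_mat u $ 1 $ 1 = 1" "n_mat u $ 1 $ 2 = 0"
  "n_mat u $ 2 $ 1 = u" "n_mat u $ 2 $ 2 = 1"
  by (simp_all add: n_mat_def)

text \<open>The torus acts on the coefficients with weights \<open>t^-3\<close>,
  \<open>t^-1\<close>, \<open>t\<close>, \<open>t^3\<close>, and the lower triangular
  \<open>n_mat u\<close> adds to each coefficient multiples of the preceding ones only.\<close>

lemma act_nakl:
  assumes "t \<noteq> 0" "act k v = (a, b, c, d)"
  shows "act (n_mat u ** a_mat t ** k ** mat l) v =
    (l * (a / t^3), l * (b / t + 3 * u * a / t^3), l * (c * t + 2 * u * b / t + 3 * u^2 * a / t^3),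
     l * (d * t^3 + u * c * t + u^2 * b / t + u^3 * a / t^3))"
proof -
  have "act (n_mat u ** a_mat t ** k ** mat l) v = l *\<^sub>R act (n_mat u) (act (a_mat t) (act k v))"
    by (simp only: act_act[symmetric] act_mat act_scale)
  also have "act (a_mat t) (act k v) = (a / t^3, b / t, c * t, d * t^3)"
    using assms det_a_mat[of t] by (simp add: Let_def field_simps power2_eq_square power3_eq_cube)
  finally show ?thesis
    by (simp add: Let_def field_simps)
qed

lemma det_nakl:
  assumes "t \<noteq> 0" "k \<in> SO2"
  shows "det (n_mat u ** a_mat t ** k ** mat l) = l\<^sup>2"
  using assms by (simp add: det_mul det_mat_2 det_SO2)

text \<open>The l1 norm on coefficients: bounds for it can be read off one coefficient at a
  time.\<close>

definition form_size :: "real cubic_form \<Rightarrow> real" where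
  "form_size = (\<lambda>(a, b, c, d). \<bar>a\<bar> + \<bar>b\<bar> + \<bar>c\<bar> + \<bar>d\<bar>)"

lemma norm_le_form_size: "norm f \<le> form_size f"
proof (cases f)
  case (fields a b c d)
  have "norm f \<le> norm a + norm (b, c, d)" unfolding fields by (rule norm_Pair_le)
  also have "norm (b, c, d) \<le> norm b + norm (c, d)" by (rule norm_Pair_le)
  also have "norm (c, d) \<le> norm c + norm d" by (rule norm_Pair_le)
  finally show ?thesis by (simp add: fields form_size_def)
qed

lemma form_size_scale: "form_size (l *\<^sub>R f) = \<bar>l\<bar> * form_size f"
  by (cases f) (simp add: form_size_def abs_mult algebra_simps)

lemma form_size_add: "form_size (f + g) \<le> form_size f + form_size g"
proof -
  have "\<bar>x + y\<bar> \<le> \<bar>x\<bar> + \<bar>y\<bar>" for x y :: real by (rule abs_triangle_ineq)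
  then show ?thesis
    by (cases f; cases g) (simp add: form_size_def add_mono algebra_simps, smt (verit))
qed

lemma form_size_nonneg [simp]: "0 \<le> form_size f"
  by (cases f) (simp add: form_size_def)

text \<open>In each new coefficient, \<open>a\<close>, \<open>b\<close>, \<open>c\<close>,
  \<open>d\<close> are multiplied by sums of at most three cubic monomials in the entries, counted
  with multiplicity. Four coefficients give \<open>12 = 4 * 3\<close>.\<close>

lemma form_size_act:
  assumes g: "\<And>i j. \<bar>g$i$j\<bar> \<le> R" and det: "\<bar>det g\<bar> = 1"
  shows "form_size (act g f) \<le> 12 * R^3 * form_size f"
proof (cases f)
  case (fields a b c d)
  define p q r s where pq: "p = g$1$1" "q = g$1$2" "r = g$2$1" "s = g$2$2"
  have R: "\<bar>p\<bar> \<le> R" "\<bar>q\<bar> \<le> R" "\<bar>r\<bar> \<le> R" "\<bar>s\<bar> \<le> R" using g by (auto simp: pq)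
  have m: "\<bar>x * (y * z)\<bar> \<le> R^3" if "\<bar>x\<bar> \<le> R" "\<bar>y\<bar> \<le> R" "\<bar>z\<bar> \<le> R" for x y z
    unfolding abs_mult power3_eq_cube mult.assoc using that
    by (intro mult_mono mult_nonneg_nonneg) auto
  have c: "\<bar>a * x + b * y + c * z + d * w\<bar> \<le> 3 * R^3 * form_size f"
    if "\<bar>x\<bar> \<le> 3 * R^3" "\<bar>y\<bar> \<le> 3 * R^3" "\<bar>z\<bar> \<le> 3 * R^3" "\<bar>w\<bar> \<le> 3 * R^3" for x y z w
  proof -
    have "\<bar>a * x + b * y + c * z + d * w\<bar> \<le> \<bar>a * x\<bar> + \<bar>b * y\<bar> + \<bar>c * z\<bar> + \<bar>d * w\<bar>" by linarith
    also have "\<dots> \<le> \<bar>a\<bar> * (3 * R^3) + \<bar>b\<bar> * (3 * R^3) + \<bar>c\<bar> * (3 * R^3) + \<bar>d\<bar> * (3 * R^3)"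
      unfolding abs_mult using that by (intro add_mono mult_left_mono) auto
    finally show ?thesis by (simp add: fields form_size_def algebra_simps)
  qed
  have m3: "\<bar>3 * x\<bar> \<le> 3 * R^3" if "\<bar>x\<bar> \<le> R^3" for x
    using that by (simp add: abs_mult)
  have m21: "\<bar>2 * x + y\<bar> \<le> 3 * R^3" if "\<bar>x\<bar> \<le> R^3" "\<bar>y\<bar> \<le> R^3" for x y
    using that by linarith
  have m1: "\<bar>x\<bar> \<le> 3 * R^3" if "\<bar>x\<bar> \<le> R^3" for x
    using that by linarith
  have "\<bar>a * (p * (p * p)) + b * (p * (p * q)) + c * (p * (q * q)) + d * (q * (q * q))\<bar>
      \<le> 3 * R^3 * form_size f"
    by (intro c m1 m R)
  then have e1: "\<bar>a * p^3 + b * p^2 * q + c * p * q^2 + d * q^3\<bar> \<le> 3 * R^3 * form_size f"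
    by (simp add: power2_eq_square power3_eq_cube algebra_simps)
  have "\<bar>a * (r * (r * r)) + b * (r * (r * s)) + c * (r * (s * s)) + d * (s * (s * s))\<bar>
      \<le> 3 * R^3 * form_size f"
    by (intro c m1 m R)
  then have e4: "\<bar>a * r^3 + b * r^2 * s + c * r * s^2 + d * s^3\<bar> \<le> 3 * R^3 * form_size f"
    by (simp add: power2_eq_square power3_eq_cube algebra_simps)
  have "\<bar>a * (3 * (p * (p * r))) + b * (2 * (p * (r * q)) + p * (p * s))
      + c * (2 * (p * (q * s)) + r * (q * q)) + d * (3 * (q * (q * s)))\<bar> \<le> 3 * R^3 * form_size f"
    by (intro c m3 m21 m R)
  then have e2: "\<bar>3 * a * p^2 * r + b * (2 * p * r * q + p^2 * s)
          + c * (r * q^2 + 2 * p * q * s) + 3 * d * q^2 * s\<bar> \<le> 3 * R^3 * form_size f"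
    by (simp add: power2_eq_square power3_eq_cube algebra_simps)
  have "\<bar>a * (3 * (p * (r * r))) + b * (2 * (p * (r * s)) + r * (r * q))
      + c * (2 * (r * (q * s)) + p * (s * s)) + d * (3 * (q * (s * s)))\<bar> \<le> 3 * R^3 * form_size f"
    by (intro c m3 m21 m R)
  then have e3: "\<bar>3 * a * p * r^2 + b * (r^2 * q + 2 * p * r * s)
          + c * (2 * r * q * s + p * s^2) + 3 * d * q * s^2\<bar> \<le> 3 * R^3 * form_size f"
    by (simp add: power2_eq_square power3_eq_cube algebra_simps)
  have "form_size (act g f) \<le> 4 * (3 * R^3 * form_size f)"
    unfolding fields act.simps Let_def form_size_def prod.case abs_divide det
    using add_mono[OF add_mono[OF add_mono[OF e1 e2] e3] e4]
    unfolding pq fields form_size_def prod.case by simp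
  then show ?thesis by simp
qed

section \<open>Irreducibility\<close>

text \<open>If \<open>a = 0\<close>, the outer variable \<open>[:0, 1:]\<close> divides the form,
  and neither it nor the quotient is a unit. This is what cuts off the cusp later.\<close>

lemma form_poly_irreducible_imp_lead_nonzero:
  assumes "irreducible (form_poly (a, b, c, d) :: rat poly poly)"
  shows "a \<noteq> 0"
proof
  assume "a = 0"
  then have "form_poly (a, b, c, d) = [:0, 1:] * [: [:0, 0, b:], [:0, c:], [:d:] :]"
    by simp
  with assms have "is_unit ([:0, 1:] :: rat poly poly) \<or> is_unit [: [:0, 0, b:], [:0, c:], [:d:] :]"
    by (metis irreducible_def)
  moreover have "\<not> is_unit ([:0, 1:] :: rat poly poly)"
    by (simp add: is_unit_poly_iff)
  moreover have "\<not> is_unit [: [:0, 0, b:], [:0, c:], [:d:] :]"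
    by (auto simp: is_unit_poly_iff is_unit_const_poly_iff)
  ultimately show False by blast
qed

text \<open>Modulo 2 the form is \<open>x^3 + x y^2 + y^3\<close>, which takes the value 1 at all
  three nonzero points.\<close>

lemma form_eval_even_descent:
  fixes a b c d x y :: int
  assumes "odd a" "even b" "odd c" "odd d" and "form_eval (a, b, c, d) x y = 0"
  shows "even x \<and> even y"
proof -
  have "even (form_eval (a, b, c, d) x y)" using assms(5) by simp
  then show ?thesis using assms(1-4) by (auto simp: even_add even_mult_iff)
qed

lemma form_poly_irreducible:
  fixes a b c d :: int
  assumes par: "odd a" "even b" "odd c" "odd d"
  shows "irreducible (form_poly (of_int a, of_int b, of_int c, of_int d) :: rat poly poly)"
proof -
  let ?f = "(of_int a, of_int b, of_int c, of_int d) :: rat cubic_form"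
  let ?F = "form_poly ?f"
  \<comment> \<open>After clearing denominators a rational zero becomes a coprime integral zero,
    which the parity argument excludes.\<close>
  have no_root: "form_eval ?f 1 y \<noteq> 0" for y
  proof
    assume z: "form_eval ?f 1 y = 0"
    obtain m n where y: "y = of_int m / of_int n" "n > 0" "coprime m n"
      by (metis Rat_cases Fract_of_int_quotient)
    have "(of_int (form_eval (a, b, c, d) n m) :: rat) = of_int n ^ 3 * form_eval ?f 1 y"
      using y(2) by (simp add: y(1) field_simps power2_eq_square power3_eq_cube)
    then have "form_eval (a, b, c, d) n m = 0" unfolding z
        by (simp only: mult_zero_right of_int_eq_0_iff)
    then have "even n \<and> even m" using form_eval_even_descent[OF par] by blast
    then show False using y(3) by (metis coprime_common_divisor odd_one)
  qed
  have d0: "d \<noteq> 0" using par by auto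
  have deg: "degree ?F = 3" and lead: "lead_coeff ?F = [:of_int d:]"
    using d0 by (simp_all add: numeral_3_eq_3)
  have F0: "?F \<noteq> 0" using deg by auto
  \<comment> \<open>The \<open>Y\<close>-leading coefficient \<open>d\<close> is a unit, so a proper factorization has a factor of
    \<open>Y\<close>-degree 1, and this yields a rational zero after putting \<open>X = 1\<close>.\<close>
  have lin: False if GH: "?F = G * H" and G: "degree G = 1" and unit: "is_unit (lead_coeff G)" for G H
  proof -
    from G obtain g0 g1 where g: "G = [:g0, g1:]" "g1 \<noteq> 0"
      by (rule degree1_coeffs)
    from unit g obtain e where e: "g1 = [:e:]" "e \<noteq> 0" 
      by (auto simp: is_unit_poly_iff)
    define y where "y = - poly g0 1 / e"
    have "form_eval ?f 1 y = poly (poly G [:y:]) 1 * poly (poly H [:y:]) 1"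
      by (simp add: poly_form_poly[symmetric] GH del: form_poly.simps form_eval.simps)
    also have "poly (poly G [:y:]) 1 = 0" using e by (simp add: g y_def)
    finally show False using no_root by simp
  qed
  have const: "is_unit G" if "degree G = 0" "is_unit (lead_coeff G)" for G :: "rat poly poly"
    using that by (auto elim!: degree_eq_zeroE simp: is_unit_const_poly_iff)
  have "is_unit G \<or> is_unit H" if GH: "?F = G * H" for G H
  proof -
    have nz: "G \<noteq> 0" "H \<noteq> 0" using F0 GH by auto
    have "degree G + degree H = 3" using deg unfolding GH degree_mult_eq[OF nz] .
    moreover have "lead_coeff G * lead_coeff H = [:of_int d:]"
      using lead GH lead_coeff_mult by metis
    then have "is_unit (lead_coeff G * lead_coeff H)"
      using d0 by (simp add: is_unit_const_poly_iff dvd_field_iff)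
    then have u: "is_unit (lead_coeff G)" "is_unit (lead_coeff H)"
      by (simp_all only: is_unit_mult_iff)
    \<comment> \<open>The \<open>Y\<close>-degrees add up to 3 and neither is 1, so one of them is
      0.\<close>
    have "degree G \<noteq> 1" using lin[OF GH _ u(1)] by blast
    moreover have "degree H \<noteq> 1" using lin[of H G] GH u(2) by (auto simp: mult.commute)
    ultimately have "degree G = 0 \<or> degree H = 0" by linarith
    then show ?thesis using const u by blast
  qed
  moreover have "\<not> is_unit ?F"
    using deg F0 by (auto simp: is_unit_poly_iff)
  ultimately show ?thesis using F0 by (auto simp: irreducible_def)
qed

section \<open>Stabilizers\<close>

lemma exists_rotation_zero: "\<exists>k\<in>SO2. form_eval (act k f) x y = 0"
  \<comment> \<open>The rotation by \<open>\<pi>\<close> changes the sign of a cubic form, so the intermediate value theorem applies.\<close>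
proof -
  define k :: "real \<Rightarrow> real^2^2" where
    "k \<theta> = vector [vector [cos \<theta>, sin \<theta>], vector [- sin \<theta>, cos \<theta>]]" for \<theta>
  have SO2: "k \<theta> \<in> SO2" for \<theta>
    by (simp add: SO2_iff k_def)
  define h where "h \<theta> = form_eval f (x * cos \<theta> - y * sin \<theta>) (x * sin \<theta> + y * cos \<theta>)" for \<theta>
  have eval: "form_eval (act (k \<theta>) f) x y = h \<theta>" for \<theta>
    using det_SO2[OF SO2[of \<theta>]]
    by (simp add: form_eval_act h_def vector_matrix_mult_def sum_2) (simp add: k_def mult.commute)
  have cont: "continuous_on {0..pi} h"
    unfolding h_def by (cases f) (auto intro!: continuous_intros)
  have "h pi = - h 0"
    by (cases f) (simp add: h_def)
  then have "\<exists>\<theta>. 0 \<le> \<theta> \<and> \<theta> \<le> pi \<and> h \<theta> = 0"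
    using IVT'[of h 0 0 pi] IVT2'[of h pi 0 0] cont by (cases "h 0 \<le> 0") auto
  then show ?thesis using SO2 eval by metis
qed

text \<open>The form is \<open>y (b x^2 + d y^2)\<close>, and its stabilizer permutes the three
  zeros. The second alternative has trace -1 and determinant 1, so it is an element of order
  3.\<close>

lemma stabilizer_normal_form:
  assumes b: "b \<noteq> 0" and d: "d \<noteq> 0" and det: "det h = 1"
    and stab: "act h (0, b, 0, d) = (0, b, 0, d)"
  shows "h = mat 1 \<or> (h$1$1 = -1/2 \<and> h$2$2 = -1/2 \<and> (h$1$2)\<^sup>2 = - b / (4 * d) \<and> h$1$2 * h$2$1 = -3/4)"
proof -
  define p q r s where pq: "p = h$1$1" "q = h$1$2" "r = h$2$1" "s = h$2$2"
  have eqs: "b * p^2 * q + d * q^3 = 0" "b * (2 * p * r * q + p^2 * s) + 3 * d * q^2 * s = b"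
     "b * (r^2 * q + 2 * p * r * s) + 3 * d * q * s^2 = 0"
    using stab by (simp_all add: Let_def det flip: pq)
  have ps: "p * s - q * r = 1" using det by (simp add: det_2 pq)
  show ?thesis
  proof (cases "q = 0")
    case True
    then have "p * s = 1" "b * (p * (p * s)) = b" "r * (p * s) = 0"
      using ps eqs b by (auto simp: power2_eq_square algebra_simps)
    then have "p = 1" "s = 1" "r = 0" using b by auto
    then have "h = mat 1" using True by (simp add: pq vec_eq_iff forall_2 mat_nth)
    then show ?thesis ..
  next
    case False
    \<comment> \<open>The zero (1, 0) is sent to (p, q), which for \<open>q \<noteq> 0\<close> must
      be a zero of the quadratic factor.\<close>
    have "q * (b * p^2 + d * q^2) = 0"
      using eqs(1) by (simp add: power2_eq_square power3_eq_cube algebra_simps)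
    then have e: "b * p^2 + d * q^2 = 0" using False by simp
    have "b * (2 * p * r * q + p^2 * s) + 3 * d * q^2 * s
        = 3 * s * (b * p^2 + d * q^2) - 2 * b * p * (p * s - q * r)"
      by (simp add: power2_eq_square algebra_simps)
    then have "b * (2 * p + 1) = 0" using eqs(2) ps e by (simp add: algebra_simps)
    then have p: "p = -1/2" using b by simp
    have q: "4 * (d * q^2) = - b" using e by (simp add: p power2_eq_square)
    have w: "q * r = - 1 - s / 2" using ps by (simp add: p)
    \<comment> \<open>The factor \<open>4 * q\<close> makes the third equation a polynomial in
      \<open>q * r\<close> and \<open>d * q^2\<close>, whose values are already known.\<close>
    have "4 * (q * (b * (r^2 * q + 2 * p * r * s) + 3 * d * q * s^2))
        = 4 * b * ((q * r)^2 - (q * r) * s) + 3 * s^2 * (4 * (d * q^2))"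
      by (simp add: p power2_eq_square algebra_simps)
    also have "\<dots> = 4 * (b * (2 * s + 1))"
      unfolding w q by (simp add: power2_eq_square algebra_simps)
    finally have "b * (2 * s + 1) = 0" using eqs(3) by simp
    then have s: "s = -1/2" using b by simp
    have "q * r = -3/4" using ps by (simp add: p s)
    moreover have "q^2 = - b / (4 * d)" using q d by (simp add: field_simps)
    ultimately show ?thesis using p s by (simp add: pq)
  qed
qed

lemma finite_stabilizer_normal_form:
  assumes b: "b \<noteq> 0" and d: "d \<noteq> 0"
  shows "finite {h. det h > 0 \<and> act h (0, b, 0, d) = (0, b, 0, d)}"
proof -
  define \<kappa> where "\<kappa> = sqrt (- b / (4 * d))"
  define m :: "real \<Rightarrow> real^2^2" where
    "m q = vector [vector [-1/2, q], vector [-3 / (4 * q), -1/2]]" for q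
  have "h \<in> insert (mat 1) (m ` {\<kappa>, -\<kappa>})"
    if h: "det h > 0" "act h (0, b, 0, d) = (0, b, 0, d)" for h
  proof -
    \<comment> \<open>Invariance of the nonzero discriminant leaves only the determinants 1 and -1,
      and the sign selects 1.\<close>
    have disc0: "disc (0, b, 0, d) \<noteq> 0" using b d by simp
    have "(det h)\<^sup>2 * disc (0, b, 0, d) = disc (0, b, 0, d)"
      using disc_act[of h "(0, b, 0, d)"] h by simp
    then have "(det h)\<^sup>2 = 1\<^sup>2" using disc0 by simp
    then have "det h = 1" using h(1) by (simp only: power2_eq_iff) linarith
    from stabilizer_normal_form[OF b d this h(2)] show ?thesis
    proof
      assume *: "h$1$1 = -1/2 \<and> h$2$2 = -1/2 \<and> (h$1$2)\<^sup>2 = - b / (4 * d) \<and> h$1$2 * h$2$1 = -3/4"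
      then have "\<bar>h$1$2\<bar> = \<kappa>" unfolding \<kappa>_def by (metis real_sqrt_abs)
      then have "h$1$2 \<in> {\<kappa>, -\<kappa>}" by auto
      moreover have "h$1$2 \<noteq> 0" using * by auto
      then have "h = m (h$1$2)" using *
        by (simp add: m_def vec_eq_iff forall_2 field_simps)
      ultimately show ?thesis by blast
    qed simp
  qed
  then have "{h. det h > 0 \<and> act h (0, b, 0, d) = (0, b, 0, d)} \<subseteq> insert (mat 1) (m ` {\<kappa>, -\<kappa>})"
    by blast
  then show ?thesis by (rule finite_subset) simp
qed

text \<open>A rotation moves a real zero to (1, 0), killing the first coefficient; then a shear
  completes the square and kills the third. A nonzero discriminant keeps the other two coefficients
  nonzero.\<close>

lemma exists_normal_form:
  assumes "disc v \<noteq> 0"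
  shows "\<exists>g b d. det g = 1 \<and> act g v = (0, b, 0, d) \<and> b \<noteq> 0 \<and> d \<noteq> 0"
proof -
  obtain k where k: "k \<in> SO2" "form_eval (act k v) 1 0 = 0"
    using exists_rotation_zero by blast
  then obtain b c d where kv: "act k v = (0, b, c, d)"
    by (cases "act k v") auto
  have "disc (act k v) \<noteq> 0" using assms disc_act[of k v] det_SO2[OF k(1)] by simp
  then have b: "b \<noteq> 0" by (auto simp: kv)
  define u where "u = - c / (2 * b)"
  obtain d' where nkv: "act (n_mat u ** k) v = (0, b, 0, d')"
    using b by (simp add: act_act[symmetric] kv Let_def u_def)
  moreover have det: "det (n_mat u ** k) = 1" by (simp add: det_mul det_SO2 k)
  moreover have "disc (0, b, 0, d') \<noteq> 0"
    using assms disc_act[of "n_mat u ** k" v] det nkv by simp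
  then have "d' \<noteq> 0" by auto
  ultimately show ?thesis using b by blast
qed

text \<open>Conjugation by the matrix that brings \<open>v\<close> into normal form maps its
  stabilizer injectively into a finite one.\<close>

lemma finite_stabilizer:
  assumes "disc v \<noteq> 0"
  shows "finite {h. det h > 0 \<and> act h v = v}"
proof -
  obtain g b d where g: "det g = 1" "act g v = (0, b, 0, d)" and bd: "b \<noteq> 0" "d \<noteq> 0"
    using exists_normal_form[OF assms] by blast
  obtain g' where g': "g' ** g = mat 1" "g ** g' = mat 1"
    using g(1) by (metis invertible_det_nz invertible_def zero_neq_one)
  have "det g' = 1" using g'(1) g(1) by (metis det_I det_mul mult.right_neutral)
  have v: "act g' (0, b, 0, d) = v"
    by (simp only: g(2)[symmetric] act_act g'(1) act_mat scaleR_one)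
  let ?c = "\<lambda>h. g ** h ** g'"
  have "?c ` {h. det h > 0 \<and> act h v = v} \<subseteq> {h. det h > 0 \<and> act h (0, b, 0, d) = (0, b, 0, d)}"
    using g(1) \<open>det g' = 1\<close>
    by (auto simp only: det_mul act_act[symmetric] v g(2) image_subset_iff mem_Collect_eq mult_1 mult_1_right)
  then have fin: "finite (?c ` {h. det h > 0 \<and> act h v = v})"
    using finite_stabilizer_normal_form[OF bd] by (rule finite_subset)
  have "g' ** ?c x ** g = x" for x
  proof -
    have "g' ** ?c x ** g = (g' ** g) ** x ** (g' ** g)"
      by (simp only: matrix_mul_assoc)
    then show ?thesis by (simp only: g'(1) matrix_mul_lid matrix_mul_rid)
  qed
  then have "inj ?c" by (rule inj_on_inverseI)
  with fin show ?thesis by (meson finite_imageD inj_on_subset subset_UNIV)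
qed

text \<open>A nonempty transporter is a left coset of the stabilizer. This bounds the multiplicity
  of a form in the multiset.\<close>

lemma transporter_finite_card:
  assumes "disc v \<noteq> 0"
  shows "finite {g. det g > 0 \<and> act g v = f} \<and>
    card {g. det g > 0 \<and> act g v = f} \<le> card {h. det h > 0 \<and> act h v = v}"
proof (cases "{g. det g > 0 \<and> act g v = f} = {}")
  case False
  then obtain g where g: "det g > 0" "act g v = f" by blast
  obtain g' where g': "g' ** g = mat 1" "g ** g' = mat 1"
    using g(1) by (metis invertible_det_nz invertible_def less_irrefl)
  have "det g' * det g = 1" using g'(1) by (metis det_I det_mul)
  then have dg': "det g' > 0" using g(1) by (metis zero_less_mult_pos2 zero_less_one)
  have "x = g ** (g' ** x)" for x by (metis g'(2) matrix_mul_assoc matrix_mul_lid)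
  moreover have "g' ** x \<in> {h. det h > 0 \<and> act h v = v}" if "det x > 0" "act x v = f" for x
  proof -
    have "act g' (act x v) = v"
      by (simp only: that(2) g(2)[symmetric] act_act g'(1) act_mat scaleR_one)
    then show ?thesis using that(1) dg' by (simp add: det_mul act_act[symmetric])
  qed
  ultimately have "{g. det g > 0 \<and> act g v = f} \<subseteq> (**) g ` {h. det h > 0 \<and> act h v = v}"
    by (smt (verit) image_eqI mem_Collect_eq subsetI)
  then show ?thesis using finite_stabilizer[OF assms]
    by (meson finite_imageI finite_subset card_image_le card_mono le_trans)
next
  case True
  then show ?thesis by (simp only: finite.emptyI card.empty) simp
qed

section \<open>Counting integral forms in a box\<close>

lemma int_ball_eq: "{q::int. \<bar>x + of_int q\<bar> \<le> m} = {\<lceil>- m - x\<rceil>..\<lfloor>m - x\<rfloor>}" for x m :: real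
  by (auto simp: ceiling_le_iff le_floor_iff abs_le_iff)

lemma card_int_ball_le:
  fixes x m :: real
  assumes "m \<ge> 0"
  shows "real (card {q::int. \<bar>x + of_int q\<bar> \<le> m}) \<le> 2 * m + 1"
proof -
  have "real_of_int (\<lfloor>m - x\<rfloor> - \<lceil>- m - x\<rceil> + 1) \<le> 2 * m + 1" by linarith
  then show ?thesis using assms by (auto simp: int_ball_eq)
qed

lemma card_int_ball_ge:
  fixes x m :: real
  shows "real (card {q::int. \<bar>x + of_int q\<bar> \<le> m}) \<ge> 2 * m - 1"
proof -
  have "real_of_int (\<lfloor>m - x\<rfloor> - \<lceil>- m - x\<rceil> + 1) \<ge> 2 * m - 1" by linarith
  then show ?thesis by (simp add: int_ball_eq)
qed

lemma int_progression_eq: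
  fixes x m :: real
  assumes "\<beta> \<noteq> 0"
  shows "{q::int. \<bar>x + \<beta> * of_int q\<bar> \<le> m} = {q::int. \<bar>x / \<beta> + of_int q\<bar> \<le> m / \<bar>\<beta>\<bar>}"
proof -
  have "\<bar>x + \<beta> * of_int q\<bar> = \<bar>\<beta>\<bar> * \<bar>x / \<beta> + of_int q\<bar>" for q :: int
    using assms by (simp add: field_simps flip: abs_mult)
  then show ?thesis using assms by (auto simp: field_simps)
qed

text \<open>The range of a coefficient may depend on those chosen before it; only a uniform bound on
  its size matters.\<close>

lemma card_Sigma_le:
  assumes "finite A" "\<And>x. x \<in> A \<Longrightarrow> real (card (B x)) \<le> M" "real (card A) \<le> N" "0 \<le> M"
    "\<And>x. x \<in> A \<Longrightarrow> finite (B x)"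
  shows "real (card (Sigma A B)) \<le> N * M"
proof -
  have "real (card (Sigma A B)) = (\<Sum>x\<in>A. real (card (B x)))"
    using assms by (simp add: card_SigmaI)
  also have "\<dots> \<le> real (card A) * M" using assms(2) by (rule sum_bounded_above)
  also have "\<dots> \<le> N * M" using assms by (intro mult_right_mono) auto
  finally show ?thesis .
qed

section \<open>Integral forms with a prescribed value at a primitive point\<close>

definition int_form :: "int cubic_form \<Rightarrow> real cubic_form" where
  "int_form = (\<lambda>(a, b, c, d). (of_int a, of_int b, of_int c, of_int d))"

lemma inj_int_form: "inj int_form"
  by (auto simp: int_form_def inj_def)

lemma form_eval_int_form: "form_eval (int_form f) (of_int x) (of_int y) = of_int (form_eval f x y)"
  by (cases f) (simp add: int_form_def)

text \<open>The coefficients of \<open>(\<beta>x - \<alpha>y)(p x\<^sup>2 + q x y + r y\<^sup>2)\<close>.\<close>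

definition vanishing_form :: "'a::comm_ring_1 \<Rightarrow> 'a \<Rightarrow> 'a \<times> 'a \<times> 'a \<Rightarrow> 'a cubic_form" where
  "vanishing_form \<alpha> \<beta> = (\<lambda>(p, q, r). (\<beta> * p, \<beta> * q - \<alpha> * p, \<beta> * r - \<alpha> * q, - \<alpha> * r))"

text \<open>Division by \<open>\<beta>x - \<alpha>y\<close>: the first three coefficients determine
  \<open>p\<close>, \<open>q\<close>, \<open>r\<close> in turn, and the zero forces the last
  one.\<close>

lemma vanishing_form_exists_real:
  fixes \<alpha> \<beta> :: real
  assumes "form_eval f \<alpha> \<beta> = 0" "\<beta> \<noteq> 0"
  shows "\<exists>q. f = vanishing_form \<alpha> \<beta> q"
proof (cases f)
  case (fields a b c d)
  define p where "p = a / \<beta>"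
  define q where "q = (b + \<alpha> * p) / \<beta>"
  define r where "r = (c + \<alpha> * q) / \<beta>"
  have e: "a = \<beta> * p" "b = \<beta> * q - \<alpha> * p" "c = \<beta> * r - \<alpha> * q"
    using assms(2) by (simp_all add: p_def q_def r_def)
  have "\<beta>^3 * (\<alpha> * r + d) = form_eval f \<alpha> \<beta>"
    by (simp add: fields e power2_eq_square power3_eq_cube algebra_simps)
  then have "d = - \<alpha> * r" using assms by simp
  then show ?thesis using e by (auto simp: fields vanishing_form_def)
qed

text \<open>The same division is exact over the integers: reducing the equation modulo
  \<open>\<beta>\<close> and cancelling a power of \<open>\<alpha>\<close> shows each numerator
  divisible by \<open>\<beta>\<close>; then one factor \<open>\<beta>\<close> is removed and the
  argument repeats.\<close>

lemma vanishing_form_exists_int: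
  fixes \<alpha> \<beta> :: int
  assumes z: "form_eval f \<alpha> \<beta> = 0" and cop: "coprime \<alpha> \<beta>" and "\<beta> \<noteq> 0"
  shows "\<exists>q. f = vanishing_form \<alpha> \<beta> q"
proof (cases f)
  case (fields a b c d)
  have cop': "coprime \<beta> (\<alpha>^n)" for n using cop by (simp add: coprime_commute)
  have "a * \<alpha>^3 = \<beta> * (- (b * \<alpha>^2 + c * \<alpha> * \<beta> + d * \<beta>^2))"
    using z by (simp add: fields power2_eq_square power3_eq_cube algebra_simps)
  then have "\<beta> dvd a" using cop' by (metis coprime_dvd_mult_left_iff dvd_triv_left)
  then obtain p where p: "a = \<beta> * p" by blast
  have "\<beta> * (p * \<alpha>^3 + b * \<alpha>^2 + c * \<alpha> * \<beta> + d * \<beta>^2) = 0"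
    using z by (simp add: fields p power2_eq_square power3_eq_cube algebra_simps)
  then have z2: "p * \<alpha>^3 + b * \<alpha>^2 + c * \<alpha> * \<beta> + d * \<beta>^2 = 0" using assms(3) by simp
  then have "(b + \<alpha> * p) * \<alpha>^2 = \<beta> * (- (c * \<alpha> + d * \<beta>))"
    by (simp add: power2_eq_square power3_eq_cube algebra_simps)
  then have "\<beta> dvd b + \<alpha> * p" using cop' by (metis coprime_dvd_mult_left_iff dvd_triv_left)
  then obtain q where "b + \<alpha> * p = \<beta> * q" by blast
  then have q: "b = \<beta> * q - \<alpha> * p" by simp
  have "\<beta> * (q * \<alpha>^2 + c * \<alpha> + d * \<beta>) = 0"
    using z2 by (simp add: q power2_eq_square power3_eq_cube algebra_simps)
  then have z3: "q * \<alpha>^2 + c * \<alpha> + d * \<beta> = 0" using assms(3) by simp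
  then have "(c + \<alpha> * q) * \<alpha>^1 = \<beta> * (- d)"
    by (simp add: power2_eq_square algebra_simps)
  then have "\<beta> dvd c + \<alpha> * q" using cop' by (metis coprime_dvd_mult_left_iff dvd_triv_left)
  then obtain r where "c + \<alpha> * q = \<beta> * r" by blast
  then have r: "c = \<beta> * r - \<alpha> * q" by simp
  have "\<beta> * (\<alpha> * r + d) = 0"
    using z3 by (simp add: r power2_eq_square algebra_simps)
  then have "d = - \<alpha> * r" using assms(3) by simp
  then show ?thesis using p q r by (auto simp: fields vanishing_form_def)
qed

text \<open>Cubes of coprime integers are coprime, so Bezout applies.\<close>

lemma exists_form_eval_eq:
  fixes \<alpha> \<beta> :: int
  assumes "coprime \<alpha> \<beta>"
  shows "\<exists>s t. form_eval (s, 0, 0, t) \<alpha> \<beta> = m"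
proof -
  obtain s t where "s * \<alpha>^3 + t * \<beta>^3 = 1"
    using bezout_int[of "\<alpha>^3" "\<beta>^3"] assms by (auto simp: coprime_iff_gcd_eq_1)
  then have "m * s * \<alpha>^3 + m * t * \<beta>^3 = m" by (metis mult.assoc distrib_left mult.right_neutral)
  then show ?thesis by (intro exI[of _ "m * s"] exI[of _ "m * t"]) simp
qed

text \<open>Subtracting one solution leaves a vanishing form, whose coordinates enter triangularly:
  given \<open>p\<close>, the values of \<open>b\<close> run through one class modulo
  \<open>\<beta>\<close>, and given \<open>q\<close> so do those of \<open>c\<close>;
  \<open>d\<close> is then determined. The \<open>+ 1\<close> covers boxes shorter than
  \<open>\<beta>\<close>.\<close>

lemma card_forms_in_box_le:
  fixes \<alpha> \<beta> :: int and A B C :: real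
  assumes cop: "coprime \<alpha> \<beta>" and \<beta>: "\<beta> \<noteq> 0" and ABC: "0 \<le> A" "0 \<le> B" "0 \<le> C"
  defines "S \<equiv> {(a, b, c, d). form_eval (a, b, c, d) \<alpha> \<beta> = 1 \<and>
    \<bar>of_int a\<bar> \<le> A \<and> \<bar>of_int b\<bar> \<le> B \<and> \<bar>of_int c\<bar> \<le> C}"
  shows "finite S"
    and "real (card S) \<le> (2 * (A / \<bar>of_int \<beta>\<bar>) + 1) * ((2 * (B / \<bar>of_int \<beta>\<bar>) + 1) * (2 * (C / \<bar>of_int \<beta>\<bar>) + 1))"
proof -
  obtain s t where st: "form_eval (s, 0, 0, t) \<alpha> \<beta> = 1"
    using exists_form_eval_eq[OF cop] by blast
  define I :: "real \<Rightarrow> real \<Rightarrow> int set" where "I x m = {q. \<bar>x + of_int \<beta> * of_int q\<bar> \<le> m}" for x m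
  have fin: "finite (I x m)" for x m
    using \<beta> by (simp add: I_def int_progression_eq int_ball_eq)
  have card: "real (card (I x m)) \<le> 2 * (m / \<bar>of_int \<beta>\<bar>) + 1" if "m \<ge> 0" for x m
    using \<beta> that card_int_ball_le[of "m / \<bar>of_int \<beta>\<bar>"] by (simp add: I_def int_progression_eq)
  define Q where "Q = Sigma (I (of_int s) A) (\<lambda>p. Sigma (I (of_int (- \<alpha> * p)) B) (\<lambda>q. I (of_int (- \<alpha> * q)) C))"
  have "f \<in> (\<lambda>q. (s, 0, 0, t) + vanishing_form \<alpha> \<beta> q) ` Q" if "f \<in> S" for f
  proof -
    from that have "form_eval (f - (s, 0, 0, t)) \<alpha> \<beta> = 0"
      using st unfolding form_eval_diff by (auto simp: S_def)
    from vanishing_form_exists_int[OF this cop \<beta>]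
    obtain p q r where eq: "f - (s, 0, 0, t) = vanishing_form \<alpha> \<beta> (p, q, r)" by (metis surj_pair)
    then have f: "f = (s, 0, 0, t) + vanishing_form \<alpha> \<beta> (p, q, r)" by (metis diff_add_cancel add.commute)
    moreover have "(p, q, r) \<in> Q"
      using that unfolding f by (auto simp: S_def Q_def I_def vanishing_form_def algebra_simps)
    ultimately show ?thesis by blast
  qed
  then have sub: "S \<subseteq> (\<lambda>q. (s, 0, 0, t) + vanishing_form \<alpha> \<beta> q) ` Q" by blast
  have finQ: "finite Q" using fin by (auto simp: Q_def)
  show "finite S" using sub finQ by (meson finite_imageI finite_subset)
  have "card S \<le> card Q" using sub finQ by (meson card_image_le card_mono finite_imageI le_trans)
  moreover have "real (card Q) \<le> (2 * (A / \<bar>of_int \<beta>\<bar>) + 1) * ((2 * (B / \<bar>of_int \<beta>\<bar>) + 1) * (2 * (C / \<bar>of_int \<beta>\<bar>) + 1))"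
    unfolding Q_def using ABC
        by (intro card_Sigma_le card fin finite_SigmaI mult_nonneg_nonneg add_nonneg_nonneg) auto
  ultimately show "real (card S) \<le> (2 * (A / \<bar>of_int \<beta>\<bar>) + 1) * ((2 * (B / \<bar>of_int \<beta>\<bar>) + 1) * (2 * (C / \<bar>of_int \<beta>\<bar>) + 1))"
    by linarith
qed

section \<open>Coefficients of forms in the orbit of the fundamental domain\<close>

lemma t0_ge: "1/2 \<le> t0"
proof -
  have "1 \<le> root 4 (3::real)" by simp
  moreover have "sqrt 2 \<le> 2" by (simp add: real_sqrt_le_iff[of 2 4, simplified])
  ultimately have "1 / 2 \<le> root 4 3 / sqrt 2" by (intro frac_le) auto
  then show ?thesis by (simp add: t0_def)
qed

lemma gauss_nu_bound:
  assumes "gauss_nu \<nu>" "u \<in> \<nu> t" "t \<ge> t0"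
  shows "\<bar>u\<bar> \<le> 1/2"
  using assms by (fastforce simp: gauss_nu_def nu_closed_def)

lemma V_int_irr_int_form:
  assumes "f \<in> V_int_irr i"
  obtains a b c d where "f = int_form (a, b, c, d)" "a \<noteq> 0"
  using assms form_poly_irreducible_imp_lead_nonzero
  by (fastforce simp: V_int_irr_def int_form_def simp del: form_poly.simps)

lemma disc_nakl:
  assumes "t \<noteq> 0" "k \<in> SO2" "l > 0"
  shows "disc (act (n_mat u ** a_mat t ** k ** mat l) v) = l^4 * disc v"
  using assms by (subst disc_act) (auto simp: det_nakl)

text \<open>Rotations keep the coefficients of \<open>v\<close> bounded, so the torus weights govern
  the size. The terms added by the shear have lower weight and are absorbed because \<open>t\<close>
  is bounded below.\<close>

lemma nakl_coefficient_bounds: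
  obtains C where "C > 0" and "\<And>u t k l. \<bar>u\<bar> \<le> 1/2 \<Longrightarrow> t \<ge> 1/2 \<Longrightarrow> k \<in> SO2 \<Longrightarrow> l > 0 \<Longrightarrow>
    (case act (n_mat u ** a_mat t ** k ** mat l) v of (a, b, c, d) \<Rightarrow>
       \<bar>a\<bar> \<le> C * l / t^3 \<and> \<bar>b\<bar> \<le> C * l / t \<and> \<bar>c\<bar> \<le> C * l * t \<and> \<bar>d\<bar> \<le> C * l * t^3)"
proof -
  define M where "M = 12 * form_size v + 1"
  have M: "M > 0" by (simp add: M_def add_nonneg_pos)
  \<comment> \<open>The four coefficients give the constants 1, 7, 17 and 15; 17 is their
    maximum.\<close>
  have "case act (n_mat u ** a_mat t ** k ** mat l) v of (a, b, c, d) \<Rightarrow>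
       \<bar>a\<bar> \<le> (17 * M) * l / t^3 \<and> \<bar>b\<bar> \<le> (17 * M) * l / t \<and> \<bar>c\<bar> \<le> (17 * M) * l * t \<and>
           \<bar>d\<bar> \<le> (17 * M) * l * t^3"
    if u: "\<bar>u\<bar> \<le> 1/2" and t: "t \<ge> 1/2" and k: "k \<in> SO2" and l: "l > 0" for u t k l
  proof -
    obtain a b c d where w: "act k v = (a, b, c, d)" by (metis surj_pair)
    have "form_size (act k v) \<le> M"
      using form_size_act[OF SO2_entry_le[OF k], of v] det_SO2[OF k] by (simp add: M_def)
    then have abcd: "\<bar>a\<bar> \<le> M" "\<bar>b\<bar> \<le> M" "\<bar>c\<bar> \<le> M" "\<bar>d\<bar> \<le> M"
      by (simp_all add: w form_size_def)
    have t0: "t > 0" using t by simp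
    have t2: "1 \<le> 4 * t^2" using power_mono[OF t, of 2] by (simp add: power2_eq_square)
    have u2: "\<bar>u\<bar>^2 \<le> 1/4" using power_mono[OF u, of 2] by (simp add: power2_eq_square)
    have u3: "\<bar>u\<bar>^3 \<le> 1/8" using power_mono[OF u, of 3] by (simp add: power3_eq_cube)
    have i1: "1 / t \<le> 4 * t" using t2 t0 by (simp add: field_simps power2_eq_square)
    have i2: "1 / t^3 \<le> 4 * (1 / t)" using t2 t0
        by (simp add: field_simps power2_eq_square power3_eq_cube)
    have i3: "t \<le> 4 * t^3" using t2 t0 by (simp add: power2_eq_square power3_eq_cube)
    have z: "0 \<le> 1/t" "0 \<le> 1/t^3" "0 \<le> t" "0 \<le> t^3" using t0 by auto
    have m: "\<bar>x * y * z\<bar> \<le> X * M * z" if "\<bar>x\<bar> \<le> X" "\<bar>y\<bar> \<le> M" "0 \<le> z" for x y z X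
      unfolding abs_mult using that M by (intro mult_mono mult_nonneg_nonneg) auto
    have "\<bar>a / t^3\<bar> \<le> 17 * M * (1 / t^3)"
      using m[of 1 17 a "1/t^3"] abcd z by simp
    moreover have "\<bar>b / t + 3 * u * a / t^3\<bar> \<le> 17 * M * (1 / t)"
    proof -
      have "\<bar>b / t + 3 * u * a / t^3\<bar> \<le> \<bar>1 * b * (1/t)\<bar> + \<bar>(3 * u) * a * (1/t^3)\<bar>"
        using abs_triangle_ineq[of "b / t" "3 * u * a / t^3"] by simp
      also have "\<dots> \<le> 1 * M * (1/t) + (3/2) * M * (1/t^3)"
        using abcd u z by (intro add_mono m) auto
      also have "\<dots> \<le> 1 * M * (1/t) + (3/2) * M * (4 * (1/t))"
        using i2 M by (intro add_mono mult_left_mono) auto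
      also have "\<dots> = 7 * (M * (1/t))" by simp
      also have "\<dots> \<le> 17 * (M * (1/t))" using M z by (intro mult_right_mono) auto
      finally show ?thesis by simp
    qed
    moreover have "\<bar>c * t + 2 * u * b / t + 3 * u^2 * a / t^3\<bar> \<le> 17 * M * t"
    proof -
      have "\<bar>c * t + 2 * u * b / t + 3 * u^2 * a / t^3\<bar>
          \<le> \<bar>1 * c * t\<bar> + \<bar>(2 * u) * b * (1/t)\<bar> + \<bar>(3 * \<bar>u\<bar>^2) * a * (1/t^3)\<bar>"
        using abs_triangle_ineq[of "c * t" "2 * u * b / t"]
          abs_triangle_ineq[of "c * t + 2 * u * b / t" "3 * u^2 * a / t^3"] by simp
      also have "\<dots> \<le> 1 * M * t + 1 * M * (1/t) + (3/4) * M * (1/t^3)"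
        using abcd u u2 z by (intro add_mono m) (auto simp: abs_mult)
      also have "\<dots> \<le> 1 * M * t + 1 * M * (4 * t) + (3/4) * M * (16 * t)"
        using i1 i2 M by (intro add_mono mult_left_mono) auto
      finally show ?thesis by simp
    qed
    moreover have "\<bar>d * t^3 + u * c * t + u^2 * b / t + u^3 * a / t^3\<bar> \<le> 17 * M * t^3"
    proof -
      have "\<bar>d * t^3 + u * c * t + u^2 * b / t + u^3 * a / t^3\<bar>
          \<le> \<bar>1 * d * t^3\<bar> + \<bar>u * c * t\<bar> + \<bar>u^2 * b * (1/t)\<bar> + \<bar>u^3 * a * (1/t^3)\<bar>"
        using abs_triangle_ineq[of "d * t^3" "u * c * t"]
          abs_triangle_ineq[of "d * t^3 + u * c * t" "u^2 * b / t"]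
          abs_triangle_ineq[of "d * t^3 + u * c * t + u^2 * b / t" "u^3 * a / t^3"] by simp
      also have "\<dots> \<le> 1 * M * t^3 + (1/2) * M * t + (1/4) * M * (1/t) + (1/8) * M * (1/t^3)"
        using abcd u u2 u3 z by (intro add_mono m) (auto simp: power_abs)
      also have "\<dots> \<le> 1 * M * t^3 + (1/2) * M * (4 * t^3) + (1/4) * M * (16 * t^3) + (1/8) * M * (64 * t^3)"
        using i1 i2 i3 M by (intro add_mono mult_left_mono) auto
      also have "\<dots> = 15 * (M * t^3)" by simp
      also have "\<dots> \<le> 17 * (M * t^3)" using M z by (intro mult_right_mono) auto
      finally show ?thesis by simp
    qed
    ultimately show ?thesis
      using l t0 unfolding act_nakl[OF less_imp_neq[OF t0, symmetric] w] prod.case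
      by (simp add: abs_mult mult_ac divide_simps) 
  qed
  then show ?thesis using that[of "17 * M"] M by simp
qed

section \<open>The cusp\<close>

text \<open>\<open>L\<close> is an upper bound for \<open>C * l\<close>: the discriminant scales by
  \<open>l^4\<close>, so the hypothesis on \<open>disc f\<close> says
  \<open>l \<le> L / C\<close>.\<close>

lemma cusp_forms_bounded:
  assumes v: "disc v \<noteq> 0" and \<nu>: "gauss_nu \<nu>"
  obtains C where "C > 0"
    and "\<And>T i L f. f \<in> (\<lambda>g. act g v) ` fund_dom_cusp \<nu> T \<Longrightarrow> f \<in> V_int_irr i \<Longrightarrow> L > 0 \<Longrightarrow>
      \<bar>disc f\<bar> \<le> \<bar>disc v\<bar> * (L / C)^4 \<Longrightarrow>
      \<exists>a b c d t. f = int_form (a, b, c, d) \<and> t > T \<and> t \<ge> 1/2 \<and> t^3 \<le> L \<and>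
        \<bar>of_int a\<bar> \<le> L / t^3 \<and> \<bar>of_int b\<bar> \<le> L / t \<and> \<bar>of_int c\<bar> \<le> L * t \<and> \<bar>of_int d\<bar> \<le> L * t^3"
proof -
  obtain C where C: "C > 0" and bound: "\<And>u t k l. \<bar>u\<bar> \<le> 1/2 \<Longrightarrow> t \<ge> 1/2 \<Longrightarrow> k \<in> SO2 \<Longrightarrow> l > 0 \<Longrightarrow>
    (case act (n_mat u ** a_mat t ** k ** mat l) v of (a, b, c, d) \<Rightarrow>
       \<bar>a\<bar> \<le> C * l / t^3 \<and> \<bar>b\<bar> \<le> C * l / t \<and> \<bar>c\<bar> \<le> C * l * t \<and> \<bar>d\<bar> \<le> C * l * t^3)"
    by (rule nakl_coefficient_bounds[of v]) blast
  have "\<exists>a b c d t. f = int_form (a, b, c, d) \<and> t > T \<and> t \<ge> 1/2 \<and> t^3 \<le> L \<and>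
        \<bar>of_int a\<bar> \<le> L / t^3 \<and> \<bar>of_int b\<bar> \<le> L / t \<and> \<bar>of_int c\<bar> \<le> L * t \<and> \<bar>of_int d\<bar> \<le> L * t^3"
    if f: "f \<in> (\<lambda>g. act g v) ` fund_dom_cusp \<nu> T" "f \<in> V_int_irr i" and L: "L > 0"
      and disc: "\<bar>disc f\<bar> \<le> \<bar>disc v\<bar> * (L / C)^4" for T i L f
  proof -
    from f(1) obtain u t k l where g: "f = act (n_mat u ** a_mat t ** k ** mat l) v"
      "u \<in> \<nu> t" "t \<ge> t0" "k \<in> SO2" "l > 0" "t > T"
      unfolding fund_dom_cusp_def by blast
    have t: "t \<ge> 1/2" using g(3) t0_ge by linarith
    obtain a b c d where abcd: "f = int_form (a, b, c, d)" "a \<noteq> 0"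
      using f(2) by (rule V_int_irr_int_form)
    have bd: "\<bar>of_int a\<bar> \<le> C * l / t^3 \<and> \<bar>of_int b\<bar> \<le> C * l / t \<and> \<bar>of_int c\<bar> \<le> C * l * t \<and>
        \<bar>of_int d\<bar> \<le> C * l * t^3"
      using bound[OF gauss_nu_bound[OF \<nu> g(2,3)] t g(4,5)] abcd(1) unfolding g(1)[symmetric]
      by (simp add: int_form_def)
    have "\<bar>disc f\<bar> = l^4 * \<bar>disc v\<bar>"
      using g t by (simp add: disc_nakl abs_mult)
    then have "l^4 \<le> (L / C)^4" using disc v by (simp add: mult.commute)
    then have "l \<le> L / C" using L C by (intro power_mono_iff[THEN iffD1, of l "L/C" 4])
        (use g(5) in auto)
    then have Cl: "C * l \<le> L" using C by (simp add: field_simps)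
    have bd': "\<bar>of_int a\<bar> \<le> L / t^3" "\<bar>of_int b\<bar> \<le> L / t" "\<bar>of_int c\<bar> \<le> L * t" "\<bar>of_int d\<bar> \<le> L * t^3"
    proof -
      have "C * l / t^3 \<le> L / t^3" "C * l / t \<le> L / t" "C * l * t \<le> L * t" "C * l * t^3 \<le> L * t^3"
        using Cl t by (auto intro!: divide_right_mono mult_right_mono)
      then show "\<bar>of_int a\<bar> \<le> L / t^3" "\<bar>of_int b\<bar> \<le> L / t" "\<bar>of_int c\<bar> \<le> L * t" "\<bar>of_int d\<bar> \<le> L * t^3"
        using bd order_trans by blast+
    qed
    \<comment> \<open>A nonzero integer is at least 1 in absolute value, which limits how high in
      the cusp an irreducible form can lie.\<close>
    have "1 \<le> \<bar>real_of_int a\<bar>" using abcd(2) by linarith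
    then have "1 \<le> L / t^3" using bd'(1) by linarith
    then have "t^3 \<le> L" using t by (simp add: field_simps)
    with abcd bd' t g(6) show ?thesis by (intro exI conjI)
  qed
  then show ?thesis by (rule that[OF C])
qed

section \<open>Finiteness of the counted sets\<close>

lemma fund_dom_cusp_subset: "fund_dom_cusp \<nu> T \<subseteq> fund_dom \<nu>"
  by (auto simp: fund_dom_def fund_dom_cusp_def)

text \<open>Height 0 lies below \<open>t0\<close>, so bounds proved for the cusp cover the whole
  domain.\<close>

lemma fund_dom_cusp_0: "fund_dom_cusp \<nu> 0 = fund_dom \<nu>"
proof -
  have "0 < t" if "t0 \<le> t" for t using that t0_ge by linarith
  then show ?thesis unfolding fund_dom_def fund_dom_cusp_def by (intro Collect_cong) blast
qed

lemma det_fund_dom: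
  assumes "g \<in> fund_dom \<nu>"
  shows "det g > 0"
proof -
  obtain u t k l where g: "g = n_mat u ** a_mat t ** k ** mat l" "t0 \<le> t" "k \<in> SO2" "l > 0"
    using assms unfolding fund_dom_def by blast
  then have "t \<noteq> 0" using t0_ge by linarith
  then show ?thesis using g by (simp add: det_nakl)
qed

lemma finite_int_forms:
  "finite {f. \<exists>a b c d. f = int_form (a, b, c, d) \<and> \<bar>of_int a\<bar> \<le> B \<and> \<bar>of_int b\<bar> \<le> B \<and>
      \<bar>of_int c\<bar> \<le> B \<and> \<bar>of_int d\<bar> \<le> B}"
  for B :: real
proof (rule finite_subset)
  let ?I = "{q::int. \<bar>0 + of_int q\<bar> \<le> B}"
  show "finite (int_form ` (?I \<times> ?I \<times> ?I \<times> ?I))"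
    unfolding int_ball_eq by (intro finite_imageI finite_cartesian_product) auto
  show "{f. \<exists>a b c d. f = int_form (a, b, c, d) \<and> \<bar>of_int a\<bar> \<le> B \<and> \<bar>of_int b\<bar> \<le> B \<and>
      \<bar>of_int c\<bar> \<le> B \<and> \<bar>of_int d\<bar> \<le> B} \<subseteq> int_form ` (?I \<times> ?I \<times> ?I \<times> ?I)"
  proof (intro subsetI, elim CollectE exE conjE)
    fix f a b c d
    assume "f = int_form (a, b, c, d)" "\<bar>of_int a\<bar> \<le> B" "\<bar>of_int b\<bar> \<le> B" "\<bar>of_int c\<bar> \<le> B" "\<bar>of_int d\<bar> \<le> B"
    then show "f \<in> int_form ` (?I \<times> ?I \<times> ?I \<times> ?I)"
      by (intro image_eqI[of _ _ "(a, b, c, d)"]) simp_all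
  qed
qed

text \<open>With \<open>t\<close> confined to a compact range all coefficients are bounded.
  Finiteness matters because a sum or cardinality over an infinite set would default to 0.\<close>

lemma finite_counted_forms:
  assumes v: "disc v \<noteq> 0" and \<nu>: "gauss_nu \<nu>"
  shows "finite {f \<in> (\<lambda>g. act g v) ` fund_dom \<nu> \<inter> V_int_irr i. \<bar>disc f\<bar> < H}"
proof -
  obtain C where C: "C > 0" and bd: "\<And>T i L f. f \<in> (\<lambda>g. act g v) ` fund_dom_cusp \<nu> T \<Longrightarrow>
      f \<in> V_int_irr i \<Longrightarrow> L > 0 \<Longrightarrow>
      \<bar>disc f\<bar> \<le> \<bar>disc v\<bar> * (L / C)^4 \<Longrightarrow>
      \<exists>a b c d t. f = int_form (a, b, c, d) \<and> t > T \<and> t \<ge> 1/2 \<and> t^3 \<le> L \<and>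
        \<bar>of_int a\<bar> \<le> L / t^3 \<and> \<bar>of_int b\<bar> \<le> L / t \<and> \<bar>of_int c\<bar> \<le> L * t \<and> \<bar>of_int d\<bar> \<le> L * t^3"
    using cusp_forms_bounded[OF v \<nu>] by metis
  \<comment> \<open>The absolute value and the \<open>+ 1\<close> keep \<open>L\<close> positive for
    every \<open>H\<close>.\<close>
  define L where "L = C * root 4 ((\<bar>H\<bar> + 1) / \<bar>disc v\<bar>)"
  have L: "L > 0" using C v by (simp add: L_def)
  have LC: "\<bar>disc v\<bar> * (L / C)^4 = \<bar>H\<bar> + 1" using C v by (simp add: L_def)
  \<comment> \<open>\<open>8 * L\<close> covers \<open>L / t^3\<close> and \<open>L / t\<close> for
    \<open>t \<ge> 1/2\<close>; \<open>L * (1 + L)\<close> covers \<open>L * t\<close> and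
    \<open>L * t^3\<close>.\<close>
  define B where "B = 8 * L + L * (1 + L)"
  have "\<exists>a b c d. f = int_form (a, b, c, d) \<and> \<bar>of_int a\<bar> \<le> B \<and> \<bar>of_int b\<bar> \<le> B \<and> \<bar>of_int c\<bar> \<le> B \<and>
      \<bar>of_int d\<bar> \<le> B"
    if f: "f \<in> (\<lambda>g. act g v) ` fund_dom \<nu>" "f \<in> V_int_irr i" "\<bar>disc f\<bar> < H" for f
  proof -
    from bd[of f 0 i L] f L LC obtain a b c d t where abcd: "f = int_form (a, b, c, d)" "t \<ge> 1/2" "t^3 \<le> L"
        "\<bar>of_int a\<bar> \<le> L / t^3" "\<bar>of_int b\<bar> \<le> L / t" "\<bar>of_int c\<bar> \<le> L * t" "\<bar>of_int d\<bar> \<le> L * t^3"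
      unfolding fund_dom_cusp_0 by fastforce
    have t3: "t^3 \<ge> 1/8" using power_mono[OF abcd(2), of 3] by (simp add: power3_eq_cube)
    have "1 \<le> t \<Longrightarrow> t^1 \<le> t^3" by (rule power_increasing) auto
    then have t: "t \<le> 1 + L" using abcd(3) L by (cases "1 \<le> t") auto
    have "L / t^3 \<le> 8 * L" using divide_left_mono[OF t3, of L] L abcd(2) by simp
    moreover have "L / t \<le> 2 * L" using divide_left_mono[OF abcd(2), of L] L abcd(2) by simp
    moreover have "L * t \<le> L * (1 + L)" "L * t^3 \<le> L * (1 + L)"
      using L t abcd(3) by (auto intro!: mult_left_mono)
    moreover have LL: "0 < L * (1 + L)" using L by simp
    ultimately have "\<bar>of_int a\<bar> \<le> B" "\<bar>of_int b\<bar> \<le> B" "\<bar>of_int c\<bar> \<le> B" "\<bar>of_int d\<bar> \<le> B"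
      using abcd(4-7) L LL unfolding B_def by linarith+
    then show ?thesis using abcd(1) by blast
  qed
  then show ?thesis
    by (intro finite_subset[OF _ finite_int_forms[of B]]) blast
qed

section \<open>Slicing the cusp by the integer part of t\<close>

lemma sum_inverse_squares_le:
  assumes "1 \<le> N" "N \<le> K"
  shows "(\<Sum>n=N..K. 1 / real n ^ 2) \<le> 2 / real N - 1 / real K"
  using assms(2)
proof (induction K rule: dec_induct)
  case base
  have "1 / real N ^ 2 \<le> 1 / real N ^ 1"
    using assms(1) by (intro divide_left_mono power_increasing) auto
  then show ?case by simp
next
  case (step K)
  \<comment> \<open>The new term is at most \<open>1 / K - 1 / (K + 1)\<close>, which telescopes
    against the subtracted \<open>1 / real K\<close> of the claim.\<close>
  have "1 / real (Suc K) ^ 2 \<le> 1 / (real K * real (Suc K))"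
    using step assms(1) by (intro divide_left_mono) (auto simp: power2_eq_square intro!: mult_right_mono)
  also have "\<dots> = 1 / real K - 1 / real (Suc K)"
    using step assms(1) by (simp add: field_simps)
  finally show ?case using step by simp
qed

lemma sum_inverse_cubes_le:
  assumes "1 \<le> N"
  shows "(\<Sum>n=N..K. 1 / real n ^ 3) \<le> 2 / real N"
proof (cases "N \<le> K")
  case True
  have "(\<Sum>n=N..K. 1 / real n ^ 3) \<le> (\<Sum>n=N..K. 1 / real n ^ 2)"
    using assms by (intro sum_mono divide_left_mono power_increasing) auto
  also have "\<dots> \<le> 2 / real N - 1 / real K" by (rule sum_inverse_squares_le[OF assms True])
  also have "\<dots> \<le> 2 / real N" by simp
  finally show ?thesis .
qed simp

text \<open>For \<open>n \<le> R\<close> the boxes for \<open>b\<close> and \<open>c\<close> are at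
  least as long as the spacing \<open>Y\<close>, so their \<open>+ 1\<close> is absorbed by
  \<open>2 * x + 1 \<le> 3 * x\<close>. The box for \<open>a\<close> may be shorter, and its
  \<open>+ 1\<close> has to stay.\<close>

lemma slice_bound:
  fixes n Y R b :: real
  assumes n1: "1 \<le> n" and nR: "n \<le> R" and Y: "0 < Y" "Y \<le> b" and R: "0 < R" "Y \<le> R^2"
  shows "(2 * (R^3 / n ^ 3 / b) + 1) * ((2 * (R^3 / n / b) + 1) * (2 * (2 * R^3 * n / b) + 1))
    \<le> 18 * R^6 / Y^2 * (2 * R^3 / Y * (1 / n ^ 3) + 1)"
proof -
  define p q r where pqr: "p = (\<lambda>y. R^3 / n / y)" "q = (\<lambda>y. 2 * R^3 * n / y)" "r = (\<lambda>y. R^3 / n^3 / y)"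
  have pos: "0 < n" "0 < Y" "0 < b" "0 < R" using assms by linarith+
  have mono: "x / b \<le> x / Y" if "0 \<le> x" for x
    using Y that by (intro divide_left_mono) auto
  have le: "p b \<le> p Y" "q b \<le> q Y" "r b \<le> r Y"
    unfolding pqr using pos by (intro mono; simp)+
  have nn: "0 \<le> p b" "0 \<le> q b" "0 \<le> r b"
    unfolding pqr using pos by simp_all
  have "n * Y \<le> R * R^2" using nR R Y by (intro mult_mono) auto
  then have p1: "1 \<le> p Y"
    unfolding pqr using pos by (simp add: field_simps power2_eq_square power3_eq_cube)
  have "R^3 / n \<le> R^3 / 1" using n1 pos by (intro divide_left_mono) simp_all
  also have "\<dots> \<le> 2 * R^3 * n" using n1 pos by simp
  finally have "p Y \<le> q Y" unfolding pqr using pos by (intro divide_right_mono) simp_all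
  with p1 have q1: "1 \<le> q Y" by linarith
  have "(2 * p b + 1) * (2 * q b + 1) \<le> (3 * p Y) * (3 * q Y)"
    using le nn p1 q1 by (intro mult_mono) linarith+
  also have "\<dots> = 18 * R^6 / Y^2"
    unfolding pqr using pos by (simp add: power2_eq_square flip: power_add)
  finally have pq: "(2 * p b + 1) * (2 * q b + 1) \<le> 18 * R^6 / Y^2" .
  have "(2 * r b + 1) * ((2 * p b + 1) * (2 * q b + 1)) \<le> (2 * r Y + 1) * (18 * R^6 / Y^2)"
    by (rule mult_mono[OF _ pq]) (use le nn pos in simp_all)
  then show ?thesis unfolding pqr by (simp add: mult.commute)
qed

text \<open>With \<open>L = R^3\<close> the cutoff becomes \<open>t \<le> R\<close>. Relative to
  \<open>R^9 / Y^3\<close>, the main terms of the slices sum to order \<open>1 / T\<close>, while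
  the extra class for \<open>a\<close>, once in each of at most \<open>R\<close> slices, contributes
  order \<open>Y / R^2\<close>.\<close>

lemma card_cusp_forms_le:
  assumes v: "disc v \<noteq> 0" and \<nu>: "gauss_nu \<nu>"
  obtains C where "C > 0"
    and "\<And>i T R Y H \<alpha> \<beta>. coprime \<alpha> \<beta> \<Longrightarrow> 0 < Y \<Longrightarrow> Y \<le> \<bar>of_int \<beta>\<bar> \<Longrightarrow> 0 < R \<Longrightarrow> Y \<le> R^2 \<Longrightarrow> 1 \<le> T \<Longrightarrow>
      H \<le> \<bar>disc v\<bar> * (R^3 / C)^4 \<Longrightarrow>
      real (card {f \<in> (\<lambda>g. act g v) ` fund_dom_cusp \<nu> T \<inter> V_int_irr i.
          form_eval f (of_int \<alpha>) (of_int \<beta>) = 1 \<and> \<bar>disc f\<bar> < H})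
        \<le> 72 * (R^9 / Y^3) * (1 / \<lfloor>T\<rfloor> + Y / R^2)"
proof -
  obtain C where C: "C > 0" and bd: "\<And>T i L f. f \<in> (\<lambda>g. act g v) ` fund_dom_cusp \<nu> T \<Longrightarrow>
      f \<in> V_int_irr i \<Longrightarrow> L > 0 \<Longrightarrow>
      \<bar>disc f\<bar> \<le> \<bar>disc v\<bar> * (L / C)^4 \<Longrightarrow>
      \<exists>a b c d t. f = int_form (a, b, c, d) \<and> t > T \<and> t \<ge> 1/2 \<and> t^3 \<le> L \<and>
        \<bar>of_int a\<bar> \<le> L / t^3 \<and> \<bar>of_int b\<bar> \<le> L / t \<and> \<bar>of_int c\<bar> \<le> L * t \<and> \<bar>of_int d\<bar> \<le> L * t^3"
    using cusp_forms_bounded[OF v \<nu>] by metis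
  have "real (card {f \<in> (\<lambda>g. act g v) ` fund_dom_cusp \<nu> T \<inter> V_int_irr i.
          form_eval f (of_int \<alpha>) (of_int \<beta>) = 1 \<and> \<bar>disc f\<bar> < H})
        \<le> 72 * (R^9 / Y^3) * (1 / \<lfloor>T\<rfloor> + Y / R^2)" (is "real (card ?S) \<le> _")
    if cop: "coprime \<alpha> \<beta>" and Y: "0 < Y" "Y \<le> \<bar>of_int \<beta>\<bar>" and R: "0 < R" "Y \<le> R^2" and T: "1 \<le> T"
      and H: "H \<le> \<bar>disc v\<bar> * (R^3 / C)^4" for i T R Y H \<alpha> \<beta>
  proof -
    define N where "N = nat \<lfloor>T\<rfloor>"
    define K where "K = nat \<lfloor>R\<rfloor>"
    have N: "1 \<le> N" "real N = \<lfloor>T\<rfloor>" using T by (simp_all add: N_def le_nat_iff)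
    have \<beta>: "\<beta> \<noteq> 0" using Y by auto
    define S where "S n = {(a, b, c, d). form_eval (a, b, c, d) \<alpha> \<beta> = 1 \<and>
      \<bar>of_int a\<bar> \<le> R^3 / real n ^ 3 \<and> \<bar>of_int b\<bar> \<le> R^3 / real n \<and>
          \<bar>of_int c\<bar> \<le> 2 * R^3 * real n}" for n :: nat
    have "f \<in> (\<Union>n\<in>{N..K}. int_form ` S n)" if f: "f \<in> ?S" for f
    proof -
      from bd[of f T i "R^3"] f R H obtain a b c d t where abcd: "f = int_form (a, b, c, d)" "t > T" "t^3 \<le> R^3"
        "\<bar>of_int a\<bar> \<le> R^3 / t^3" "\<bar>of_int b\<bar> \<le> R^3 / t" "\<bar>of_int c\<bar> \<le> R^3 * t"
        by fastforce
      define n where "n = nat \<lfloor>t\<rfloor>"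
      have t: "t > 1" using T abcd(2) by linarith
      have "t \<le> R" using abcd(3) R t by (simp add: power_mono_iff)
      then have "N \<le> n" "n \<le> K" using abcd(2)
          by (auto simp: N_def n_def K_def intro!: nat_mono floor_mono)
      have "real n = of_int \<lfloor>t\<rfloor>" "1 \<le> \<lfloor>t\<rfloor>" using t by (simp_all add: n_def)
      \<comment> \<open>Here \<open>t < n + 1 \<le> 2 * n\<close>, which explains the factor 2 in
        the box for \<open>c\<close>.\<close>
      then have n: "1 \<le> real n" "real n \<le> t" "t \<le> 2 * real n" by linarith+
      have "R^3 / t^3 \<le> R^3 / real n ^ 3" "R^3 / t \<le> R^3 / real n" "R^3 * t \<le> R^3 * (2 * real n)"
        using n R by (auto intro!: divide_left_mono mult_left_mono power_mono mult_pos_pos)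
      then have "\<bar>of_int a\<bar> \<le> R^3 / real n ^ 3" "\<bar>of_int b\<bar> \<le> R^3 / real n" "\<bar>of_int c\<bar> \<le> 2 * R^3 * real n"
        using abcd(4-6) by linarith+
      moreover have "real_of_int (form_eval (a, b, c, d) \<alpha> \<beta>) = 1"
        using f by (simp only: abcd(1) mem_Collect_eq form_eval_int_form)
      then have "form_eval (a, b, c, d) \<alpha> \<beta> = 1" by (simp only: of_int_eq_1_iff)
      ultimately have "(a, b, c, d) \<in> S n"
        unfolding S_def by blast
      then show ?thesis using abcd(1) \<open>N \<le> n\<close> \<open>n \<le> K\<close> by auto
    qed
    then have sub: "?S \<subseteq> (\<Union>n\<in>{N..K}. int_form ` S n)" by blast
    have "finite (S n) \<and> real (card (S n)) \<le> 18 * R^6 / Y^2 * (2 * R^3 / Y * (1 / real n ^ 3) + 1)"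
      if n: "n \<in> {N..K}" for n
    proof
      have n1: "1 \<le> real n" using n N by simp
      have "real n \<le> real K" using n by simp
      also have "real K \<le> R" using R by (simp add: K_def)
      finally have nR: "real n \<le> R" .
      have nn: "0 \<le> R^3 / real n ^ 3" "0 \<le> R^3 / real n" "0 \<le> 2 * R^3 * real n" using R by auto
      show "finite (S n)" unfolding S_def by (rule card_forms_in_box_le(1)[OF cop \<beta> nn])
      have "real (card (S n)) \<le> (2 * (R^3 / real n ^ 3 / \<bar>of_int \<beta>\<bar>) + 1) *
         ((2 * (R^3 / real n / \<bar>of_int \<beta>\<bar>) + 1) * (2 * (2 * R^3 * real n / \<bar>of_int \<beta>\<bar>) + 1))"
        unfolding S_def by (rule card_forms_in_box_le(2)[OF cop \<beta> nn])
      also have "\<dots> \<le> 18 * R^6 / Y^2 * (2 * R^3 / Y * (1 / real n ^ 3) + 1)"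
        using Y R n1 nR by (intro slice_bound) auto
      finally show "real (card (S n)) \<le> 18 * R^6 / Y^2 * (2 * R^3 / Y * (1 / real n ^ 3) + 1)" .
    qed
    note S = this
    have "card ?S \<le> card (\<Union>n\<in>{N..K}. int_form ` S n)"
      using S by (intro card_mono sub) auto
    also have "\<dots> \<le> (\<Sum>n\<in>{N..K}. card (int_form ` S n))" by (rule card_UN_le) simp
    also have "\<dots> \<le> (\<Sum>n\<in>{N..K}. card (S n))" using S by (intro sum_mono card_image_le) auto
    finally have "real (card ?S) \<le> (\<Sum>n\<in>{N..K}. real (card (S n)))" by (simp flip: of_nat_sum)
    also have "\<dots> \<le> (\<Sum>n\<in>{N..K}. 18 * R^6 / Y^2 * (2 * R^3 / Y * (1 / real n ^ 3) + 1))"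
      using S by (intro sum_mono) auto
    also have "\<dots> = 18 * R^6 / Y^2 * (2 * R^3 / Y * (\<Sum>n\<in>{N..K}. 1 / real n ^ 3) + real (card {N..K}))"
      by (simp only: sum_distrib_left sum.distrib sum_constant mult_1_right distrib_left) (simp only: mult.commute)
    also have "\<dots> \<le> 18 * R^6 / Y^2 * (2 * R^3 / Y * (2 / real N) + R)"
    proof -
      have "card {N..K} \<le> K" using N(1) by simp
      also have "real K \<le> R" using R by (simp add: K_def)
      finally show ?thesis
        using R Y sum_inverse_cubes_le[OF N(1), of K] by (intro mult_left_mono add_mono) auto
    qed
    \<comment> \<open>\<open>72 = 18 * 2 * 2\<close> from the main term; the other term is
      \<open>18 * R^7 / Y^2\<close>, a quarter of \<open>72 * R^7 / Y^2\<close>.\<close>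
    also have "\<dots> = 72 * (R^9 / Y^3) * (1 / real N + (Y / R^2) / 4)"
      using R Y N(1) by (simp add: field_simps eval_nat_numeral)
    also have "\<dots> \<le> 72 * (R^9 / Y^3) * (1 / real N + Y / R^2)"
    proof -
      have "(Y / R^2) / 4 \<le> Y / R^2" using R Y by (simp add: divide_le_eq)
      then show ?thesis using R Y by (intro mult_left_mono add_left_mono) auto
    qed
    finally show ?thesis unfolding N(2) .
  qed
  then show ?thesis using that C by blast
qed

section \<open>Openness of orbits\<close>

text \<open>The derivative of \<open>g \<mapsto> act g v\<close> at the identity in direction \<open>(p q; r s)\<close>; its determinant
  is a multiple of \<open>disc v\<close>.\<close>

definition infinitesimal_act :: "real cubic_form \<Rightarrow> real \<times> real \<times> real \<times> real \<Rightarrow> real cubic_form" where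
  "infinitesimal_act = (\<lambda>(a, b, c, d) (p, q, r, s).
     (2 * a * p + b * q - a * s, b * p + 2 * c * q + 3 * a * r,
      3 * d * q + 2 * b * r + c * s, c * r + 2 * d * s - d * p))"

lemma linear_infinitesimal_act: "linear (infinitesimal_act v)"
  by (cases v) (auto simp: infinitesimal_act_def intro!: linearI simp: algebra_simps)

text \<open>In the spirit of Cramer's rule, the four equations force each unknown times the
  discriminant to vanish.\<close>

lemma inj_infinitesimal_act:
  assumes "disc v \<noteq> 0"
  shows "inj (infinitesimal_act v)"
proof -
  obtain a b c d where v: "v = (a, b, c, d)" by (cases v) auto
  have "(p, q, r, s) = 0" if z: "infinitesimal_act v (p, q, r, s) = 0" for p q r s
  proof -
    have eqs: "2 * a * p + b * q - a * s = 0" "b * p + 2 * c * q + 3 * a * r = 0"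
      "3 * d * q + 2 * b * r + c * s = 0" "c * r + 2 * d * s - d * p = 0"
      using z by (simp_all add: infinitesimal_act_def v zero_prod_def)
    have "p * disc v = 0" unfolding v disc.simps using eqs by algebra
    moreover have "q * disc v = 0" unfolding v disc.simps using eqs by algebra
    moreover have "r * disc v = 0" unfolding v disc.simps using eqs by algebra
    moreover have "s * disc v = 0" unfolding v disc.simps using eqs by algebra
    ultimately show ?thesis using assms by (simp add: zero_prod_def)
  qed
  then show ?thesis
    unfolding linear_injective_0[OF linear_infinitesimal_act] by (metis surj_pair)
qed

text \<open>Matrices in tuple coordinates: the orbit map then goes from the type of forms to itself,
  and an injective derivative is surjective.\<close>

definition mat4 :: "real \<times> real \<times> real \<times> real \<Rightarrow> real^2^2" where
  "mat4 = (\<lambda>(p, q, r, s). vector [vector [p, q], vector [r, s]])"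

lemma mat4_nth: "mat4 x $ 1 $ 1 = fst x" "mat4 x $ 1 $ 2 = fst (snd x)"
  "mat4 x $ 2 $ 1 = fst (snd (snd x))" "mat4 x $ 2 $ 2 = snd (snd (snd x))"
  by (simp_all add: mat4_def split_beta)

lemma orbit_map_has_derivative:
  "((\<lambda>x. act (mat4 x) v) has_derivative infinitesimal_act v) (at (1, 0, 0, 1))"
proof (cases v)
  case (fields a b c d)
  show ?thesis
    unfolding fields act.simps Let_def mat4_nth det_2
    by (auto intro!: derivative_eq_intros simp: infinitesimal_act_def split_beta algebra_simps)
qed

lemma orbit_map_continuous:
  "continuous_on {x. det (mat4 x) \<noteq> 0} (\<lambda>x. act (mat4 x) v)"
proof (cases v)
  case (fields a b c d)
  show ?thesis
    unfolding fields act.simps Let_def mat4_nth det_2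
    by (intro continuous_intros) auto
qed

text \<open>The derivative of the orbit map at the identity is invertible, so the open mapping
  theorem for a map with surjective derivative at a point applies to any small ball around the
  identity.\<close>

lemma orbit_contains_neighbourhood:
  assumes v: "disc v \<noteq> 0" and "\<eta> > 0"
  obtains \<epsilon> where "\<epsilon> > 0"
    and "\<And>w. form_size (w - v) < \<epsilon> \<Longrightarrow> \<exists>h. act h v = w \<and> (\<forall>i j. \<bar>h$i$j - mat 1$i$j\<bar> < \<eta>)"
proof -
  let ?S = "{x. det (mat4 x) \<noteq> 0}" and ?e = "(1, 0, 0, 1) :: real \<times> real \<times> real \<times> real"
  let ?F = "\<lambda>x. act (mat4 x) v"
  have open_S: "open ?S"
    unfolding det_2 mat4_nth by (intro open_Collect_neq continuous_intros)
  have "surj (infinitesimal_act v)"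
    using linear_infinitesimal_act inj_infinitesimal_act[OF v]
        by (rule linear_injective_imp_surjective) (rule refl)
  then obtain g' where g': "linear g'" "infinitesimal_act v \<circ> g' = id"
    using linear_surjective_right_inverse[OF linear_infinitesimal_act] by blast
  have e: "?e \<in> ball ?e \<eta> \<inter> ?S" using \<open>\<eta> > 0\<close> by (simp add: det_2 mat4_nth)
  have "?F ?e \<in> interior (?F ` (ball ?e \<eta> \<inter> ?S))"
  proof (rule sussmann_open_mapping[OF open_S orbit_map_continuous _ orbit_map_has_derivative _ g'(2)])
    show "bounded_linear g'" using g'(1) by (simp add: linear_conv_bounded_linear)
    show "?e \<in> interior (ball ?e \<eta> \<inter> ?S)" using e open_S by (simp add: interior_open open_Int)
  qed (use e in auto)
  moreover have "mat4 ?e = mat 1" by (simp add: vec_eq_iff forall_2 mat4_nth mat_nth)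
  ultimately have "v \<in> interior (?F ` (ball ?e \<eta> \<inter> ?S))" by (simp add: act_mat)
  then obtain \<epsilon> where \<epsilon>: "\<epsilon> > 0" "ball v \<epsilon> \<subseteq> ?F ` (ball ?e \<eta> \<inter> ?S)"
    by (auto simp: mem_interior)
  have "\<exists>h. act h v = w \<and> (\<forall>i j. \<bar>h$i$j - mat 1$i$j\<bar> < \<eta>)" if "form_size (w - v) < \<epsilon>" for w
  proof -
    have "dist v w < \<epsilon>" using that norm_le_form_size[of "w - v"]
        by (simp add: dist_norm norm_minus_commute)
    then have "w \<in> ball v \<epsilon>" by simp
    with \<epsilon>(2) have "w \<in> ?F ` (ball ?e \<eta> \<inter> ?S)" by (rule subsetD)
    then obtain x where x: "x \<in> ball ?e \<eta>" "w = ?F x" by blast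
    obtain p q r s where pqrs: "x = (p, q, r, s)" by (cases x) auto
    have "norm (x - ?e) < \<eta>" using x(1) by (metis mem_ball dist_norm dist_commute)
    then have n: "norm (p - 1, q, r, s - 1) < \<eta>" by (simp add: pqrs)
    have "\<bar>p - 1\<bar> < \<eta>" using order_le_less_trans[OF norm_fst_le n] by simp
    moreover have n2: "norm (q, r, s - 1) < \<eta>" using order_le_less_trans[OF norm_snd_le n] .
    then have "\<bar>q\<bar> < \<eta>" using order_le_less_trans[OF norm_fst_le n2] by simp
    moreover have n3: "norm (r, s - 1) < \<eta>" using order_le_less_trans[OF norm_snd_le n2] .
    then have "\<bar>r\<bar> < \<eta>" "\<bar>s - 1\<bar> < \<eta>"
      using order_le_less_trans[OF norm_fst_le n3] order_le_less_trans[OF norm_snd_le n3] by simp_all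
    ultimately have "\<forall>i j. \<bar>mat4 x$i$j - mat 1$i$j\<bar> < \<eta>"
      by (simp add: forall_2 mat4_nth mat_nth pqrs)
    then show ?thesis using x(2) by blast
  qed
  then show ?thesis using that \<epsilon>(1) by blast
qed

section \<open>Iwasawa coordinates near an interior point of the domain\<close>

lemma iwasawa_decomposition:
  fixes g :: "real^2^2"
  assumes det: "det g > 0"
  defines "\<rho> \<equiv> sqrt ((g$1$1)^2 + (g$1$2)^2)"
  shows "\<exists>k\<in>SO2. g = n_mat ((g$1$1 * g$2$1 + g$1$2 * g$2$2) / \<rho>^2) ** a_mat (sqrt (det g) / \<rho>) ** k ** mat (sqrt (det g))"
proof -
  define p q r s where pq: "p = g$1$1" "q = g$1$2" "r = g$2$1" "s = g$2$2"
  define l where "l = sqrt (det g)"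
  have l: "l > 0" "l * l = p * s - q * r"
    using det by (simp_all add: l_def) (simp add: det_2 pq)
  have "p \<noteq> 0 \<or> q \<noteq> 0" using det by (auto simp: det_2 pq)
  then have pos: "p^2 + q^2 > 0" by (simp add: sum_power2_gt_zero_iff)
  then have \<rho>: "\<rho> > 0" "\<rho> * \<rho> = p * p + q * q" by (simp_all add: \<rho>_def pq power2_eq_square)
  have nz: "p * p + q * q \<noteq> 0" by (metis pos less_irrefl power2_eq_square)
  \<comment> \<open>Gram-Schmidt on the rows: the first row of the product is \<open>l / t\<close>
    times that of \<open>k\<close>, so its length \<open>\<rho>\<close> gives \<open>t\<close> and
    its direction gives \<open>k\<close>; the inner product of the two rows is
    \<open>u * \<rho>^2\<close>.\<close>
  define k :: "real^2^2" where "k = vector [vector [p / \<rho>, q / \<rho>], vector [- q / \<rho>, p / \<rho>]]"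
  have "(p / \<rho>)^2 + (q / \<rho>)^2 = (p * p + q * q) / (\<rho> * \<rho>)"
    by (simp add: power2_eq_square add_divide_distrib)
  also have "\<dots> = 1" unfolding \<rho>(2)[symmetric] using \<rho>(1) by simp
  finally have "k \<in> SO2" by (simp add: SO2_iff k_def)
  moreover have "g = n_mat ((p * r + q * s) / \<rho>^2) ** a_mat (l / \<rho>) ** k ** mat l"
  proof -
    have 1: "r = ((p * r + q * s) * p - (l * l) * q) / (\<rho> * \<rho>)"
      unfolding l(2) \<rho>(2) using nz by (simp add: eq_divide_eq algebra_simps)
    have 2: "s = ((p * r + q * s) * q + (l * l) * p) / (\<rho> * \<rho>)"
      unfolding l(2) \<rho>(2) using nz by (simp add: eq_divide_eq algebra_simps)
    have 3: "r = ((p * r + q * s) / \<rho>^2 * (\<rho> / l) * (p / \<rho>) + l / \<rho> * (- q / \<rho>)) * l"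
      by (subst 1) (use l(1) \<rho>(1) in \<open>simp add: field_simps power2_eq_square\<close>)
    have 4: "s = ((p * r + q * s) / \<rho>^2 * (\<rho> / l) * (q / \<rho>) + l / \<rho> * (p / \<rho>)) * l"
      by (subst 2) (use l(1) \<rho>(1) in \<open>simp add: field_simps power2_eq_square\<close>)
    show ?thesis
      using l(1) \<rho>(1) 3 4
      by (simp add: vec_eq_iff forall_2 matrix_matrix_mult_def sum_2 mat_nth k_def flip: pq)
  qed
  ultimately show ?thesis unfolding pq l_def by blast
qed

lemma t0_le_1: "t0 \<le> 1"
proof -
  have "root 4 3 \<le> root 4 (4::real)" by simp
  also have "root 4 (4::real) = sqrt 2"
    by (intro real_root_pos_unique) (simp_all add: power4_eq_xxxx)
  finally show ?thesis by (simp add: t0_def)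
qed

text \<open>\<open>a_mat 2 ** k\<close> has \<open>t = 2\<close> and \<open>u = 0\<close>. A small
  perturbation keeps \<open>t \<ge> 1\<close> and \<open>\<bar>u\<bar> \<le> 1/2\<close>, a region
  where \<open>\<nu> t\<close> is prescribed exactly and its ambiguity at boundary points does not
  interfere.\<close>

lemma fund_dom_near:
  assumes \<nu>: "gauss_nu \<nu>" and k: "k \<in> SO2" and h: "\<And>i j. \<bar>h$i$j - mat 1$i$j\<bar> < 1/100" and "\<mu> > 0"
  shows "a_mat 2 ** k ** h ** mat \<mu> \<in> fund_dom \<nu>"
proof -
  define x y where xy: "x = k$1$1" "y = k$1$2"
  have k': "k$2$1 = - y" "k$2$2 = x" and xy1: "x^2 + y^2 = 1" using k by (auto simp: SO2_iff xy)
  have x: "\<bar>x\<bar> \<le> 1" and y: "\<bar>y\<bar> \<le> 1"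
    using SO2_entry_le[OF k] by (simp_all add: xy)
  define e1 e2 e3 e4 where e: "e1 = h$1$1 - 1" "e2 = h$1$2" "e3 = h$2$1" "e4 = h$2$2 - 1"
  have e_le: "\<bar>e1\<bar> \<le> 1/100" "\<bar>e2\<bar> \<le> 1/100" "\<bar>e3\<bar> \<le> 1/100" "\<bar>e4\<bar> \<le> 1/100"
    using h[of 1 1] h[of 1 2] h[of 2 1] h[of 2 2] by (simp_all add: e mat_nth)
  have h': "h$1$1 = 1 + e1" "h$1$2 = e2" "h$2$1 = e3" "h$2$2 = 1 + e4" by (simp_all add: e)
  have m: "\<bar>X * Y\<bar> \<le> a * b" if "\<bar>X\<bar> \<le> a" "\<bar>Y\<bar> \<le> b" for X Y a b :: real
    unfolding abs_mult using that by (intro mult_mono) auto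
  \<comment> \<open>The entries of \<open>k ** (h - mat 1)\<close>, each a sum of two terms of size
    at most 1/100.\<close>
  define A B C D where ABCD: "A = x * e1 + y * e3" "B = x * e2 + y * e4" "C = x * e3 - y * e1" "D = x * e4 - y * e2"
  have A: "\<bar>A\<bar> \<le> 1/50" using m[OF x e_le(1)] m[OF y e_le(3)] unfolding ABCD by linarith
  have B: "\<bar>B\<bar> \<le> 1/50" using m[OF x e_le(2)] m[OF y e_le(4)] unfolding ABCD by linarith
  have C: "\<bar>C\<bar> \<le> 1/50" using m[OF x e_le(3)] m[OF y e_le(1)] unfolding ABCD by linarith
  have D: "\<bar>D\<bar> \<le> 1/50" using m[OF x e_le(4)] m[OF y e_le(2)] unfolding ABCD by linarith
  define g where "g = a_mat 2 ** k ** h"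
  have g: "g$1$1 = (x + A) / 2" "g$1$2 = (y + B) / 2" "g$2$1 = 2 * (C - y)" "g$2$2 = 2 * (x + D)"
    by (simp_all add: g_def matrix_matrix_mult_def sum_2 k' h' flip: xy) (simp_all add: ABCD algebra_simps)
  have det: "det g = (1 + e1) * (1 + e4) - e2 * e3"
    by (simp add: g_def det_mul det_SO2[OF k]) (simp add: det_2 h')
  have "e1 * e4 \<ge> - 1/10000" "e2 * e3 \<le> 1/10000"
    using m[OF e_le(1,4)] m[OF e_le(2,3)] by linarith+
  then have det_ge: "det g \<ge> 97/100"
    using e_le unfolding det by (simp add: algebra_simps)
  define \<rho> where "\<rho> = sqrt ((g$1$1)^2 + (g$1$2)^2)"
  have "\<rho>^2 = (g$1$1)^2 + (g$1$2)^2" by (simp add: \<rho>_def)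
  then have \<rho>2: "4 * \<rho>^2 = 1 + 2 * (x * A) + 2 * (y * B) + A * A + B * B"
    using xy1 by (simp add: g power2_eq_square field_simps)
  note bounds = m[OF x A] m[OF y B] m[OF A A] m[OF B B] zero_le_square[of A] zero_le_square[of B]
  have \<rho>2_le: "4 * \<rho>^2 \<le> 11/10" using bounds unfolding \<rho>2 by linarith
  have \<rho>2_ge: "4 * \<rho>^2 \<ge> 92/100" using bounds unfolding \<rho>2 by linarith
  then have \<rho>: "\<rho> > 0" by (simp add: \<rho>_def)
  define t where "t = sqrt (det g) / \<rho>"
  define u where "u = (g$1$1 * g$2$1 + g$1$2 * g$2$2) / \<rho>^2"
  have "\<rho>^2 \<le> det g" using \<rho>2_le det_ge by linarith
  then have "\<rho> \<le> sqrt (det g)" by (rule real_le_rsqrt)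
  then have t: "t \<ge> 1" using \<rho> by (simp add: t_def)
  \<comment> \<open>The rows of \<open>a_mat 2 ** k\<close> are orthogonal, so only perturbation
    terms survive: \<open>4/50 + 2/2500\<close> is below 81/1000.\<close>
  have num: "g$1$1 * g$2$1 + g$1$2 * g$2$2 = x * C - y * A + A * C + (y * D + x * B + B * D)"
    by (simp add: g field_simps)
  have "\<bar>g$1$1 * g$2$1 + g$1$2 * g$2$2\<bar> \<le> 81/1000"
    using m[OF x C] m[OF y A] m[OF A C] m[OF y D] m[OF x B] m[OF B D] unfolding num by linarith
  also have "\<dots> \<le> 1/2 * \<rho>^2" using \<rho>2_ge by linarith
  finally have "\<bar>u\<bar> \<le> 1/2" using \<rho> by (simp add: u_def abs_div divide_le_eq)
  then have u: "u \<in> \<nu> t" using \<nu> t by (auto simp: gauss_nu_def)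
  have "det g > 0" using det_ge by linarith
  then obtain k' where k': "k' \<in> SO2" "g = n_mat u ** a_mat t ** k' ** mat (sqrt (det g))"
    using iwasawa_decomposition[of g] unfolding u_def t_def \<rho>_def by blast
  have "g ** mat \<mu> = n_mat u ** a_mat t ** k' ** mat (sqrt (det g) * \<mu>)"
  proof -
    have "mat (sqrt (det g)) ** mat \<mu> = (mat (sqrt (det g) * \<mu>) :: real^2^2)"
      by (simp add: vec_eq_iff forall_2 matrix_matrix_mult_def sum_2 mat_nth)
    then show ?thesis by (subst k'(2)) (simp only: matrix_mul_assoc[symmetric])
  qed
  moreover have "sqrt (det g) * \<mu> > 0" using \<open>det g > 0\<close> \<open>\<mu> > 0\<close> by simp
  moreover have "t \<ge> t0" using t t0_le_1 by linarith
  ultimately show ?thesis unfolding g_def fund_dom_def using u k'(1) by blast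
qed

section \<open>Integral forms near a vanishing form\<close>

lemma disc_scale: "disc (l *\<^sub>R f) = l^4 * disc f" for f :: "real cubic_form"
  by (cases f) (simp add: power2_eq_square power3_eq_cube power4_eq_xxxx algebra_simps)

lemma disc_near:
  fixes v :: "real cubic_form"
  assumes "\<kappa> > 0"
  obtains \<epsilon> where "\<epsilon> > 0" "\<And>w. form_size (w - v) < \<epsilon> \<Longrightarrow> \<bar>disc w - disc v\<bar> < \<kappa>"
proof -
  have disc_eq: "disc = (\<lambda>f :: real cubic_form. (fst (snd f))^2 * (fst (snd (snd f)))^2 - 4 * fst f * (fst (snd (snd f)))^3
     - 4 * (fst (snd f))^3 * snd (snd (snd f)) - 27 * (fst f)^2 * (snd (snd (snd f)))^2
     + 18 * fst f * fst (snd f) * fst (snd (snd f)) * snd (snd (snd f)))"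
    by (simp add: fun_eq_iff)
  have "isCont disc v" unfolding disc_eq by (intro continuous_intros)
  then obtain \<epsilon> where \<epsilon>: "\<epsilon> > 0" "\<And>w. dist w v < \<epsilon> \<Longrightarrow> dist (disc w) (disc v) < \<kappa>"
    using assms unfolding continuous_at_eps_delta by blast
  have "\<bar>disc w - disc v\<bar> < \<kappa>" if "form_size (w - v) < \<epsilon>" for w
    using \<epsilon>(2)[of w] that norm_le_form_size[of "w - v"] by (simp add: dist_norm)
  then show ?thesis using that \<epsilon>(1) by blast
qed

text \<open>A rotation \<open>k\<close> makes \<open>act (a_mat 2 ** k) v\<close> vanish at the
  point, and \<open>\<mu>\<close> times it serves as \<open>f\<^sub>0\<close>; by homogeneity the
  radius grows with \<open>\<mu>\<close>. Once \<open>\<bar>disc v\<bar> * \<mu>^4\<close> is the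
  midpoint of \<open>lo\<close> and \<open>hi\<close> times \<open>X\<close>, the discriminant
  bounds become the window from \<open>lo * X\<close> to \<open>hi * X\<close>.\<close>

lemma fund_dom_orbit_region:
  fixes lo hi :: real
  assumes v: "disc v \<noteq> 0" and \<nu>: "gauss_nu \<nu>" and lohi: "0 < lo" "lo < hi"
  obtains r where "r > 0" and "\<And>\<alpha> \<beta> \<mu>. \<mu> > 0 \<Longrightarrow> \<exists>f\<^sub>0. form_eval f\<^sub>0 \<alpha> \<beta> = 0 \<and>
    (\<forall>f. form_size (f - f\<^sub>0) \<le> r * \<mu> \<longrightarrow> f \<in> (\<lambda>g. act g v) ` fund_dom \<nu> \<and>
      lo * (\<bar>disc v\<bar> * \<mu>^4) \<le> (lo + hi) / 2 * \<bar>disc f\<bar> \<and>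
      (lo + hi) / 2 * \<bar>disc f\<bar> < hi * (\<bar>disc v\<bar> * \<mu>^4))"
proof -
  define c where "c = (lo + hi) / 2"
  \<comment> \<open>\<open>c * \<kappa>\<close> is \<open>\<bar>disc v\<bar>\<close> times the
    half-width of the window.\<close>
  define \<kappa> where "\<kappa> = (hi - lo) / 2 * \<bar>disc v\<bar> / c"
  have c: "c > 0" using lohi by (simp add: c_def)
  have \<kappa>: "\<kappa> > 0" using lohi v c by (simp add: \<kappa>_def)
  obtain \<epsilon>1 where \<epsilon>1: "\<epsilon>1 > 0" "\<And>w. form_size (w - v) < \<epsilon>1 \<Longrightarrow> \<bar>disc w - disc v\<bar> < \<kappa>"
    using disc_near[OF \<kappa>] by blast
  obtain \<epsilon>2 where \<epsilon>2: "\<epsilon>2 > 0"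
    "\<And>w. form_size (w - v) < \<epsilon>2 \<Longrightarrow> \<exists>h. act h v = w \<and> (\<forall>i j. \<bar>h$i$j - mat 1$i$j\<bar> < 1/100)"
    using orbit_contains_neighbourhood[OF v, of "1/100"] by auto
  \<comment> \<open>Pulling back to \<open>v\<close> costs a factor \<open>12 * 2^3 = 96\<close> in
    size, which is below 200.\<close>
  define r where "r = min \<epsilon>1 \<epsilon>2 / 200"
  have r: "r > 0" using \<epsilon>1 \<epsilon>2 by (simp add: r_def)
  have "\<exists>f\<^sub>0. form_eval f\<^sub>0 \<alpha> \<beta> = 0 \<and>
    (\<forall>f. form_size (f - f\<^sub>0) \<le> r * \<mu> \<longrightarrow> f \<in> (\<lambda>g. act g v) ` fund_dom \<nu> \<and>
      lo * (\<bar>disc v\<bar> * \<mu>^4) \<le> c * \<bar>disc f\<bar> \<and> c * \<bar>disc f\<bar> < hi * (\<bar>disc v\<bar> * \<mu>^4))"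
    if \<mu>: "\<mu> > 0" for \<alpha> \<beta> \<mu>
  proof -
    have a2: "det (a_mat 2) = 1" by simp
    \<comment> \<open>The point \<open>(\<alpha> / 2, 2 * \<beta>)\<close> is the row vector
      \<open>(\<alpha>, \<beta>)\<close> times \<open>a_mat 2\<close>.\<close>
    obtain k where k: "k \<in> SO2" "form_eval (act k v) (\<alpha> / 2) (\<beta> * 2) = 0"
      using exists_rotation_zero by blast
    define G where "G = a_mat 2 ** k"
    define G' where "G' = transpose k ** a_mat (1/2)"
    have G0: "form_eval (act G v) \<alpha> \<beta> = 0"
      using k(2) by (simp add: G_def act_act[symmetric] form_eval_act[of "a_mat 2"] a2
          vector_matrix_mult_def sum_2 del: form_eval.simps)
    have kk: "k ** transpose k = mat 1" using k(1) by (simp add: SO2_def orthogonal_matrix_def)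
    have aa: "a_mat 2 ** a_mat (1/2) = mat 1"
      by (simp add: vec_eq_iff forall_2 matrix_matrix_mult_def sum_2 mat_nth)
    have GG': "G ** G' = mat 1"
      unfolding G_def G'_def by (metis aa kk matrix_mul_assoc matrix_mul_rid)
    then have G'G: "G' ** G = mat 1" by (simp add: matrix_left_right_inverse)
    have detG: "det G = 1" using det_SO2[OF k(1)] by (simp add: G_def det_mul)
    have detG': "det G' = 1" using det_SO2[OF k(1)] by (simp add: G'_def det_mul)
    have G'_le: "\<bar>G'$i$j\<bar> \<le> 2" for i j
    proof -
      \<comment> \<open>\<open>a_mat (1/2)\<close> multiplies the columns by 2 and 1/2; the halved
        column yields the bound 2 in the form \<open>\<le> 4\<close>.\<close>
      have "\<bar>k$i$j\<bar> \<le> 4" for i j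
        by (rule order_trans[OF SO2_entry_le[OF k(1)]]) simp
      then have "\<forall>i j. \<bar>G'$i$j\<bar> \<le> 2"
        using SO2_entry_le[OF k(1)]
        by (simp add: G'_def forall_2 matrix_matrix_mult_def sum_2 transpose_def abs_mult)
      then show ?thesis by blast
    qed
    show ?thesis
    proof (intro exI[of _ "\<mu> *\<^sub>R act G v"] conjI allI impI)
      show "form_eval (\<mu> *\<^sub>R act G v) \<alpha> \<beta> = 0" unfolding form_eval_scale G0 by simp
      fix f
      assume f: "form_size (f - \<mu> *\<^sub>R act G v) \<le> r * \<mu>"
      \<comment> \<open>Undoing \<open>G\<close> and the scaling carries the ball around
        \<open>f\<^sub>0\<close> into the neighbourhood of \<open>v\<close> where openness and
        continuity apply.\<close>
      define w where "w = act G' ((1/\<mu>) *\<^sub>R f)"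
      have "act G' ((1/\<mu>) *\<^sub>R (f - \<mu> *\<^sub>R act G v)) = w - act G' (act G v)"
        using \<mu> by (simp only: w_def scaleR_diff_right act_diff scaleR_scaleR) simp
      also have "act G' (act G v) = v" by (simp only: act_act G'G act_mat scaleR_one)
      finally have "form_size (w - v) = form_size (act G' ((1/\<mu>) *\<^sub>R (f - \<mu> *\<^sub>R act G v)))" by simp
      also have "\<dots> \<le> 12 * 2^3 * form_size ((1/\<mu>) *\<^sub>R (f - \<mu> *\<^sub>R act G v))"
        using G'_le detG' by (intro form_size_act) auto
      also have "\<dots> \<le> 12 * 2^3 * r"
        using f \<mu> unfolding form_size_scale by (simp add: field_simps)
      also have "\<dots> < 200 * r" using r by simp
      finally have near: "form_size (w - v) < \<epsilon>1" "form_size (w - v) < \<epsilon>2" by (auto simp: r_def)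
      have fw: "f = \<mu> *\<^sub>R act G w"
        unfolding w_def using \<mu> by (simp only: act_act GG' act_mat scaleR_one scaleR_scaleR) simp
      obtain h where h: "act h v = w" "\<And>i j. \<bar>h$i$j - mat 1$i$j\<bar> < 1/100"
        using \<epsilon>2(2)[OF near(2)] by blast
      have "f = act (mat \<mu>) (act G (act h v))" by (simp only: fw act_mat h(1))
      also have "\<dots> = act G (act h (act (mat \<mu>) v))" by (simp only: act_mat act_scale)
      also have "\<dots> = act (a_mat 2 ** k ** h ** mat \<mu>) v" by (simp only: act_act G_def matrix_mul_assoc)
      finally show "f \<in> (\<lambda>g. act g v) ` fund_dom \<nu>"
        using fund_dom_near[OF \<nu> k(1) h(2) \<mu>] by blast
      have disc_f: "disc f = \<mu>^4 * disc w"
        unfolding fw disc_scale using detG by (simp add: disc_act)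
      have "\<bar>disc w - disc v\<bar> < \<kappa>" by (rule \<epsilon>1(2)[OF near(1)])
      then have "\<bar>\<bar>disc w\<bar> - \<bar>disc v\<bar>\<bar> < \<kappa>" by linarith
      then have "\<bar>c * \<bar>disc w\<bar> - c * \<bar>disc v\<bar>\<bar> < c * \<kappa>"
        using c by (simp add: abs_mult flip: right_diff_distrib)
      moreover have "c * \<kappa> = hi * \<bar>disc v\<bar> - c * \<bar>disc v\<bar>" "c * \<kappa> = c * \<bar>disc v\<bar> - lo * \<bar>disc v\<bar>"
        using c by (simp_all add: \<kappa>_def) (simp_all add: c_def field_simps)
      ultimately have cw: "lo * \<bar>disc v\<bar> \<le> c * \<bar>disc w\<bar>" "c * \<bar>disc w\<bar> < hi * \<bar>disc v\<bar>"
        by linarith+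
      have \<mu>4: "\<mu>^4 > 0" using \<mu> by simp
      show "lo * (\<bar>disc v\<bar> * \<mu>^4) \<le> c * \<bar>disc f\<bar>" "c * \<bar>disc f\<bar> < hi * (\<bar>disc v\<bar> * \<mu>^4)"
        using mult_left_mono[OF cw(1) less_imp_le[OF \<mu>4]] mult_strict_left_mono[OF cw(2) \<mu>4]
        unfolding disc_f by (simp_all add: abs_mult mult_ac)
    qed
  qed
  then show ?thesis using that[OF r] unfolding c_def by blast
qed

lemma form_size_vanishing_form:
  "form_size (vanishing_form \<alpha> \<beta> (p, q, r)) \<le> (\<bar>\<alpha>\<bar> + \<bar>\<beta>\<bar>) * (\<bar>p\<bar> + \<bar>q\<bar> + \<bar>r\<bar>)"
proof -
  have "\<bar>\<beta> * q - \<alpha> * p\<bar> \<le> \<bar>\<beta>\<bar> * \<bar>q\<bar> + \<bar>\<alpha>\<bar> * \<bar>p\<bar>" "\<bar>\<beta> * r - \<alpha> * q\<bar> \<le> \<bar>\<beta>\<bar> * \<bar>r\<bar> + \<bar>\<alpha>\<bar> * \<bar>q\<bar>"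
    by (metis abs_mult abs_triangle_ineq4)+
  then show ?thesis
    unfolding vanishing_form_def form_size_def prod.case abs_mult abs_minus_cancel
    by (simp add: algebra_simps)
qed

text \<open>Start from one integral solution \<open>f1\<close> with the required parities and add
  twice integral vanishing forms: value and parities persist, and the three free coordinates can be
  brought close to those of \<open>f\<^sub>0\<close>.\<close>

lemma card_forms_near_ge:
  fixes \<alpha> \<beta> :: int and Y \<rho> :: real
  assumes cop: "coprime \<alpha> \<beta>" and Y: "1 \<le> Y"
    and \<alpha>: "Y \<le> \<bar>of_int \<alpha>\<bar>" "\<bar>of_int \<alpha>\<bar> < 2 * Y" and \<beta>: "Y \<le> \<bar>of_int \<beta>\<bar>" "\<bar>of_int \<beta>\<bar> < 2 * Y"
    and f\<^sub>0: "form_eval f\<^sub>0 (of_int \<alpha>) (of_int \<beta>) = 0" and \<rho>: "48 * Y \<le> \<rho>"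
    and "finite S"
    and S: "\<And>a b c d. odd a \<Longrightarrow> even b \<Longrightarrow> odd c \<Longrightarrow> odd d \<Longrightarrow> form_eval (a, b, c, d) \<alpha> \<beta> = 1 \<Longrightarrow>
      form_size (int_form (a, b, c, d) - f\<^sub>0) \<le> \<rho> \<Longrightarrow> int_form (a, b, c, d) \<in> S"
  shows "(\<rho> / (48 * Y))^3 \<le> real (card S)"
proof -
  have nz: "\<alpha> \<noteq> 0" "\<beta> \<noteq> 0" using \<alpha> \<beta> Y by auto
  have "\<not> (even \<alpha> \<and> even \<beta>)" using cop by (metis coprime_common_divisor odd_one)
  \<comment> \<open>\<open>x^3 + x y^2 + y^3\<close> is odd at a coprime point, so its deviation
    from 1 is even and is corrected by adding twice \<open>(s, 0, 0, t)\<close>.\<close>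
  then have "even (1 - form_eval (1, 0, 1, 1) \<alpha> \<beta>)" by auto
  then obtain z where z: "1 - form_eval (1, 0, 1, 1) \<alpha> \<beta> = 2 * z" by (rule evenE)
  obtain s t where st: "form_eval (s, 0, 0, t) \<alpha> \<beta> = z" using exists_form_eval_eq[OF cop] by blast
  define f1 :: "int cubic_form" where "f1 = (1 + 2 * s, 0, 1, 1 + 2 * t)"
  have f1: "form_eval f1 \<alpha> \<beta> = 1"
    using z by (simp add: f1_def st[symmetric] algebra_simps)
  \<comment> \<open>A small real form with value 1 at the point, so that subtracting it leaves a
    real vanishing form.\<close>
  define e :: "real cubic_form" where "e = (1 / of_int \<alpha> ^ 3, 0, 0, 0)"
  have e1: "form_eval e (of_int \<alpha>) (of_int \<beta>) = 1" using nz by (simp add: e_def)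
  have "1 \<le> \<bar>real_of_int \<alpha>\<bar> ^ 3" using \<alpha>(1) Y by (intro one_le_power) linarith
  then have "1 / \<bar>real_of_int \<alpha>\<bar> ^ 3 \<le> 1 / 1" by (intro frac_le) auto
  moreover have "form_size e = 1 / \<bar>real_of_int \<alpha>\<bar> ^ 3"
    by (simp add: e_def form_size_def power_abs)
  ultimately have e_size: "form_size e \<le> \<rho> / 2" using \<rho> Y by simp
  have "form_eval (int_form f1 - e - f\<^sub>0) (of_int \<alpha>) (of_int \<beta>) = 0"
    unfolding form_eval_diff form_eval_int_form f1 e1 f\<^sub>0 by simp
  from vanishing_form_exists_real[OF this] nz
  obtain P Q R where PQR: "int_form f1 - e - f\<^sub>0 = vanishing_form (of_int \<alpha>) (of_int \<beta>) (P, Q, R)"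
    by (metis of_int_eq_0_iff surj_pair)
  \<comment> \<open>\<open>(4 * Y) * (3 * m) = \<rho> / 2\<close>; the other half of the radius is
    left for \<open>e\<close>. As \<open>m \<ge> 2\<close>, each coordinate has at least
    \<open>m - 1 \<ge> m / 2\<close> choices.\<close>
  define m where "m = \<rho> / (24 * Y)"
  define I where "I x = {q::int. \<bar>x / 2 + of_int q\<bar> \<le> m / 2}" for x :: real
  have I_fin: "finite (I x)" for x unfolding I_def int_ball_eq by simp
  have m2: "2 \<le> m" using \<rho> Y by (simp add: m_def le_divide_eq)
  have I_card: "m / 2 \<le> real (card (I x))" for x
    using card_int_ball_ge[where x = "x / 2" and m = "m / 2"] m2 unfolding I_def by linarith
  define F where "F = (\<lambda>(p, q, r). int_form (f1 + vanishing_form \<alpha> \<beta> (2 * p, 2 * q, 2 * r)))"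
  have "inj F"
    using nz by (auto simp: F_def inj_def f1_def vanishing_form_def dest!: injD[OF inj_int_form])
  moreover have "F (p, q, r) \<in> S" if "p \<in> I P" "q \<in> I Q" "r \<in> I R" for p q r
  proof -
    have le: "\<bar>P + 2 * of_int p\<bar> \<le> m" "\<bar>Q + 2 * of_int q\<bar> \<le> m" "\<bar>R + 2 * of_int r\<bar> \<le> m"
      using that unfolding I_def mem_Collect_eq by linarith+
    define V where "V = vanishing_form (real_of_int \<alpha>) (of_int \<beta>) (P + 2 * of_int p, Q + 2 * of_int q, R + 2 * of_int r)"
    have "F (p, q, r) - f\<^sub>0 = e + ((int_form f1 - e - f\<^sub>0)
        + vanishing_form (of_int \<alpha>) (of_int \<beta>) (2 * of_int p, 2 * of_int q, 2 * of_int r))"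
      by (cases f\<^sub>0) (simp add: F_def f1_def int_form_def vanishing_form_def e_def)
    also have "\<dots> = e + V"
      unfolding PQR by (simp add: V_def vanishing_form_def algebra_simps)
    finally have eV: "F (p, q, r) - f\<^sub>0 = e + V" .
    have "form_size V \<le> (\<bar>real_of_int \<alpha>\<bar> + \<bar>of_int \<beta>\<bar>) *
        (\<bar>P + 2 * of_int p\<bar> + \<bar>Q + 2 * of_int q\<bar> + \<bar>R + 2 * of_int r\<bar>)"
      unfolding V_def by (rule form_size_vanishing_form)
    also have "\<dots> \<le> (4 * Y) * (3 * m)"
      using le \<alpha> \<beta> Y by (intro mult_mono) auto
    also have "\<dots> = \<rho> / 2" using Y by (simp add: m_def)
    finally have size: "form_size (F (p, q, r) - f\<^sub>0) \<le> \<rho>"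
      unfolding eV using e_size form_size_add[of e V] by linarith
    define A B C D where ABCD: "A = 1 + 2 * s + \<beta> * (2 * p)" "B = \<beta> * (2 * q) - \<alpha> * (2 * p)"
      "C = 1 + (\<beta> * (2 * r) - \<alpha> * (2 * q))" "D = 1 + 2 * t - \<alpha> * (2 * r)"
    have F: "F (p, q, r) = int_form (A, B, C, D)"
      by (simp add: F_def f1_def vanishing_form_def ABCD)
    have "form_eval (A, B, C, D) \<alpha> \<beta> = form_eval f1 \<alpha> \<beta>"
      by (simp add: f1_def ABCD power2_eq_square power3_eq_cube algebra_simps)
    then show ?thesis
      unfolding F using S[of A B C D] size[unfolded F] f1 by (simp add: ABCD del: form_eval.simps)
  qed
  then have "F ` (I P \<times> I Q \<times> I R) \<subseteq> S" by blast
  ultimately have card: "card (I P \<times> I Q \<times> I R) \<le> card S"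
    using \<open>finite S\<close> by (metis card_image card_mono inj_on_subset subset_UNIV)
  have "(\<rho> / (48 * Y))^3 = (m / 2) * ((m / 2) * (m / 2))"
    by (simp add: m_def power3_eq_cube)
  also have "\<dots> \<le> real (card (I P)) * (real (card (I Q)) * real (card (I R)))"
    using m2 by (intro mult_mono I_card) auto
  also have "\<dots> = real (card (I P \<times> I Q \<times> I R))" by (simp add: card_cartesian_product)
  also have "\<dots> \<le> real (card S)" using card by simp
  finally show ?thesis .
qed

section \<open>Non-escape of mass\<close>

text \<open>Multiplicities are bounded by the transporter lemma, and the lower discriminant bound is
  dropped.\<close>

lemma N_count_cusp_le:
  assumes v: "disc v \<noteq> 0" and \<nu>: "gauss_nu \<nu>"
  shows "N_count (fund_dom_cusp \<nu> T) v i lo hi P X \<le>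
    card {f \<in> (\<lambda>g. act g v) ` fund_dom_cusp \<nu> T \<inter> V_int_irr i.
        form_eval f (of_int (fst P)) (of_int (snd P)) = 1 \<and> \<bar>disc f\<bar> < hi * X} *
    card {h. det h > 0 \<and> act h v = v}" (is "_ \<le> card ?S * ?M")
proof -
  let ?U = "{f \<in> (\<lambda>g. act g v) ` fund_dom_cusp \<nu> T \<inter> V_int_irr i.
        form_eval f (of_int (fst P)) (of_int (snd P)) = 1 \<and> lo * X \<le> \<bar>disc f\<bar> \<and> \<bar>disc f\<bar> < hi * X}"
  have "?S \<subseteq> {f \<in> (\<lambda>g. act g v) ` fund_dom \<nu> \<inter> V_int_irr i. \<bar>disc f\<bar> < hi * X}"
    using fund_dom_cusp_subset[of \<nu> T] by blast
  then have fin: "finite ?S" using finite_counted_forms[OF v \<nu>] by (rule finite_subset)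
  have "card {g \<in> fund_dom_cusp \<nu> T. act g v = f} \<le> ?M" for f
  proof -
    have "{g \<in> fund_dom_cusp \<nu> T. act g v = f} \<subseteq> {g. det g > 0 \<and> act g v = f}"
      using fund_dom_cusp_subset[of \<nu> T] det_fund_dom[of _ \<nu>] by blast
    then show ?thesis using transporter_finite_card[OF v, of f] by (meson card_mono le_trans)
  qed
  then have "N_count (fund_dom_cusp \<nu> T) v i lo hi P X \<le> card ?U * ?M"
    unfolding N_count_def using sum_bounded_above[of ?U _ ?M] by simp
  also have "\<dots> \<le> card ?S * ?M" by (intro mult_right_mono card_mono[OF fin]) auto
  finally show ?thesis .
qed

text \<open>Each counted form has multiplicity at least 1; this rests on finiteness of the
  transporter, as \<open>card\<close> of an infinite set is 0.\<close>

lemma N_count_ge: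
  fixes lo hi X :: real and P :: "int \<times> int" and i :: nat
  assumes v: "disc v \<noteq> 0" and \<nu>: "gauss_nu \<nu>"
  defines "S \<equiv> {f \<in> (\<lambda>g. act g v) ` fund_dom \<nu> \<inter> V_int_irr i.
        form_eval f (of_int (fst P)) (of_int (snd P)) = 1 \<and> lo * X \<le> \<bar>disc f\<bar> \<and> \<bar>disc f\<bar> < hi * X}"
  shows "finite S" and "card S \<le> N_count (fund_dom \<nu>) v i lo hi P X"
proof -
  have "S \<subseteq> {f \<in> (\<lambda>g. act g v) ` fund_dom \<nu> \<inter> V_int_irr i. \<bar>disc f\<bar> < hi * X}"
    unfolding S_def by blast
  then show "finite S" using finite_counted_forms[OF v \<nu>] by (rule finite_subset)
  have "1 \<le> card {g \<in> fund_dom \<nu>. act g v = f}" if "f \<in> S" for f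
  proof -
    have "{g \<in> fund_dom \<nu>. act g v = f} \<subseteq> {g. det g > 0 \<and> act g v = f}"
      using det_fund_dom[of _ \<nu>] by blast
    then have "finite {g \<in> fund_dom \<nu>. act g v = f}"
      using transporter_finite_card[OF v, of f] by (meson finite_subset)
    moreover have "{g \<in> fund_dom \<nu>. act g v = f} \<noteq> {}" using that unfolding S_def by blast
    ultimately show ?thesis by (simp add: Suc_le_eq card_gt_0_iff)
  qed
  then have "(\<Sum>f\<in>S. 1) \<le> (\<Sum>f\<in>S. card {g \<in> fund_dom \<nu>. act g v = f})" by (rule sum_mono)
  then show "card S \<le> N_count (fund_dom \<nu>) v i lo hi P X" unfolding N_count_def S_def by simp
qed

lemma V_int_irr_intro:
  assumes "odd a" "even b" "odd c" "odd d" and "int_form (a, b, c, d) \<in> V_real i"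
  shows "int_form (a, b, c, d) \<in> V_int_irr i"
  using assms form_poly_irreducible[OF assms(1-4)]
  unfolding V_int_irr_def int_form_def prod.case by blast

lemma V_real_act:
  assumes "v \<in> V_real i" "det g > 0"
  shows "act g v \<in> V_real i"
  using assms by (simp add: V_real_def disc_act zero_less_mult_iff mult_less_0_iff split: if_splits)

lemma finite_prim_points: "finite (prim_points Y)"
proof (rule finite_subset)
  show "prim_points Y \<subseteq> {- \<lceil>2 * Y\<rceil>..\<lceil>2 * Y\<rceil>} \<times> {- \<lceil>2 * Y\<rceil>..\<lceil>2 * Y\<rceil>}"
    unfolding prim_points_def by (clarsimp simp: abs_less_iff; linarith)
qed simp

text \<open>Consecutive integers are coprime, and \<open>n + 1 < Y + 2 \<le> 2 * Y\<close> when
  \<open>Y \<ge> 2\<close>.\<close>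

lemma prim_points_nonempty:
  assumes "2 \<le> Y"
  shows "prim_points Y \<noteq> {}"
proof -
  obtain n :: int where "of_int n < Y + 1" "Y \<le> of_int n"
    by (rule that[of "\<lceil>Y\<rceil>"]) linarith+
  then have "(n, n + 1) \<in> prim_points Y"
    using assms by (auto simp: prim_points_def)
  then show ?thesis by blast
qed

text \<open>Bounds uniform in the point pass to the quotient of the sums because the number of
  points cancels.\<close>

lemma sum_ratio_le:
  fixes f g :: "'a \<Rightarrow> nat"
  assumes "finite A" "A \<noteq> {}" "\<And>x. x \<in> A \<Longrightarrow> real (f x) \<le> F" "\<And>x. x \<in> A \<Longrightarrow> G \<le> real (g x)" "G > 0"
  shows "0 < (\<Sum>x\<in>A. g x)" and "real (\<Sum>x\<in>A. f x) / real (\<Sum>x\<in>A. g x) \<le> F / G"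
proof -
  have A: "real (card A) > 0" using assms by (simp add: card_gt_0_iff)
  have f: "real (\<Sum>x\<in>A. f x) \<le> real (card A) * F"
    unfolding of_nat_sum using assms(3) by (rule sum_bounded_above)
  have g: "real (card A) * G \<le> real (\<Sum>x\<in>A. g x)"
    unfolding of_nat_sum using assms(4) by (rule sum_bounded_below)
  have AG: "real (card A) * G > 0" using A assms(5) by simp
  then have "0 < real (\<Sum>x\<in>A. g x)" using g by linarith
  then show "0 < (\<Sum>x\<in>A. g x)" by (simp only: of_nat_0_less_iff)
  have "real (\<Sum>x\<in>A. f x) / real (\<Sum>x\<in>A. g x) \<le> (real (card A) * F) / (real (card A) * G)"
    using order_trans[OF of_nat_0_le_iff f] f g AG by (intro frac_le)
  then show "real (\<Sum>x\<in>A. f x) / real (\<Sum>x\<in>A. g x) \<le> F / G" using A by simp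
qed

text \<open>Both counts are measured against \<open>R^9 / Y^3\<close> uniformly in \<open>P\<close>,
  and this factor cancels in \<open>F / G\<close>.\<close>

lemma cusp_ratio_bound:
  assumes lohi: "0 < lo" "lo < hi" and \<nu>: "gauss_nu \<nu>" and vV: "v \<in> V_real i"
  obtains K a r where "K > 0" "a > 0" "r > 0"
    and "\<And>X Y R T. 0 < X \<Longrightarrow> 2 \<le> Y \<Longrightarrow> R = a * X powr (1/12) \<Longrightarrow> Y \<le> R^2 \<Longrightarrow> 48 * Y \<le> r * R^3 \<Longrightarrow> 1 \<le> T \<Longrightarrow>
      0 < J_count (fund_dom \<nu>) v i lo hi Y X \<and>
      real (J_count (fund_dom_cusp \<nu> T) v i lo hi Y X) / real (J_count (fund_dom \<nu>) v i lo hi Y X)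
        \<le> K * (1 / \<lfloor>T\<rfloor> + Y / R^2)"
proof -
  have v: "disc v \<noteq> 0" using vV by (auto simp: V_real_def split: if_splits)
  define D where "D = \<bar>disc v\<bar>"
  have D: "D > 0" using v by (simp add: D_def)
  define c where "c = (lo + hi) / 2"
  have c: "c > 0" using lohi by (simp add: c_def)
  define M where "M = card {h. det h > 0 \<and> act h v = v}"
  \<comment> \<open>The identity lies in the finite stabilizer, so \<open>M\<close> and later
    \<open>K\<close> are positive.\<close>
  have "mat 1 \<in> {h. det h > 0 \<and> act h v = v}" by (simp add: act_mat)
  then have "{h. det h > 0 \<and> act h v = v} \<noteq> {}" by blast
  then have M: "M > 0" unfolding M_def card_gt_0_iff using finite_stabilizer[OF v] by blast
  obtain C where C: "C > 0"
    and cusp: "\<And>i T R Y H \<alpha> \<beta>. coprime \<alpha> \<beta> \<Longrightarrow> 0 < Y \<Longrightarrow> Y \<le> \<bar>of_int \<beta>\<bar> \<Longrightarrow> 0 < R \<Longrightarrow> Y \<le> R^2 \<Longrightarrow> 1 \<le> T \<Longrightarrow>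
      H \<le> \<bar>disc v\<bar> * (R^3 / C)^4 \<Longrightarrow>
      real (card {f \<in> (\<lambda>g. act g v) ` fund_dom_cusp \<nu> T \<inter> V_int_irr i.
          form_eval f (of_int \<alpha>) (of_int \<beta>) = 1 \<and> \<bar>disc f\<bar> < H})
        \<le> 72 * (R^9 / Y^3) * (1 / \<lfloor>T\<rfloor> + Y / R^2)"
    by (rule card_cusp_forms_le[OF v \<nu>]) (rule that)
  obtain r0 where r0: "r0 > 0" and region': "\<And>\<alpha> \<beta> \<mu>. \<mu> > 0 \<Longrightarrow> \<exists>f\<^sub>0. form_eval f\<^sub>0 \<alpha> \<beta> = 0 \<and>
    (\<forall>f. form_size (f - f\<^sub>0) \<le> r0 * \<mu> \<longrightarrow> f \<in> (\<lambda>g. act g v) ` fund_dom \<nu> \<and>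
      lo * (\<bar>disc v\<bar> * \<mu>^4) \<le> (lo + hi) / 2 * \<bar>disc f\<bar> \<and>
      (lo + hi) / 2 * \<bar>disc f\<bar> < hi * (\<bar>disc v\<bar> * \<mu>^4))"
    by (rule fund_dom_orbit_region[OF v \<nu> lohi]) (rule that)
  note region = region'[folded D_def c_def]
  \<comment> \<open>Chosen so that \<open>hi * X = D * (R^3 / C)^4\<close>, the largest cutoff
    allowed in the cusp bound.\<close>
  define a where "a = root 3 (C * root 4 (hi / D))"
  have a: "a > 0" using C D lohi by (simp add: a_def)
  have a12: "a^12 = C^4 * (hi / D)"
  proof -
    have "a^12 = (a^3)^4" by (simp flip: power_mult)
    then show ?thesis using C D lohi by (simp add: a_def power_mult_distrib)
  qed
  \<comment> \<open>Chosen so that \<open>\<mu> = \<kappa> * R^3\<close> satisfies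
    \<open>D * \<mu>^4 = c * X\<close>, placing the discriminant of the central form at the midpoint
    of the window in absolute value.\<close>
  define \<kappa> where "\<kappa> = root 4 (c / hi) / C"
  have \<kappa>: "\<kappa> > 0" "\<kappa>^4 = c / hi / C^4" using c C lohi by (simp_all add: \<kappa>_def power_divide)
  define r where "r = r0 * \<kappa>"
  have r: "r > 0" using r0 \<kappa> by (simp add: r_def)
  define K where "K = 72 * real M / (r / 48)^3"
  have K: "K > 0" using M r by (simp add: K_def)
  have "0 < J_count (fund_dom \<nu>) v i lo hi Y X \<and>
      real (J_count (fund_dom_cusp \<nu> T) v i lo hi Y X) / real (J_count (fund_dom \<nu>) v i lo hi Y X)
        \<le> K * (1 / \<lfloor>T\<rfloor> + Y / R^2)"
    if X: "0 < X" and Y: "2 \<le> Y" and R_eq: "R = a * X powr (1/12)" and YR: "Y \<le> R^2" "48 * Y \<le> r * R^3"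
      and T: "1 \<le> T" for X Y R T
  proof -
    have R: "R > 0" using a X by (simp add: R_eq)
    have "(X powr (1/12))^12 = X" using X by (simp add: powr_power)
    then have R12: "R^12 = C^4 * (hi / D) * X" by (simp add: R_eq power_mult_distrib a12)
    have hiX: "hi * X = D * (R^3 / C)^4"
      using C D by (simp add: power_divide R12 flip: power_mult)
    define \<mu> where "\<mu> = \<kappa> * R^3"
    have \<mu>: "\<mu> > 0" using \<kappa> R by (simp add: \<mu>_def)
    have D\<mu>: "D * \<mu>^4 = c * X"
      using C D lohi by (simp add: \<mu>_def power_mult_distrib \<kappa>(2) R12 flip: power_mult)
    define F where "F = 72 * (R^9 / Y^3) * (1 / \<lfloor>T\<rfloor> + Y / R^2) * real M"
    define G where "G = (r / 48)^3 * (R^9 / Y^3)"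
    have G: "G > 0" using r R Y by (simp add: G_def)
    have upper: "real (N_count (fund_dom_cusp \<nu> T) v i lo hi P X) \<le> F"
      and lower: "G \<le> real (N_count (fund_dom \<nu>) v i lo hi P X)" if P: "P \<in> prim_points Y" for P
    proof -
      obtain \<alpha> \<beta> where \<alpha>\<beta>: "P = (\<alpha>, \<beta>)" by (cases P) auto
      have cop: "coprime \<alpha> \<beta>" and \<alpha>: "Y \<le> \<bar>of_int \<alpha>\<bar>" "\<bar>of_int \<alpha>\<bar> < 2 * Y"
        and \<beta>: "Y \<le> \<bar>of_int \<beta>\<bar>" "\<bar>of_int \<beta>\<bar> < 2 * Y"
        using P by (auto simp: prim_points_def \<alpha>\<beta>)
      have "real (N_count (fund_dom_cusp \<nu> T) v i lo hi P X) \<le>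
        real (card {f \<in> (\<lambda>g. act g v) ` fund_dom_cusp \<nu> T \<inter> V_int_irr i.
          form_eval f (of_int \<alpha>) (of_int \<beta>) = 1 \<and> \<bar>disc f\<bar> < hi * X}) * real M"
        using N_count_cusp_le[OF v \<nu>, of T i lo hi P X]
        unfolding M_def[symmetric] \<alpha>\<beta> fst_conv snd_conv of_nat_mult[symmetric] of_nat_le_iff .
      also have "\<dots> \<le> F"
        unfolding F_def using R Y YR T \<beta> cop hiX
        by (intro mult_right_mono cusp) (auto simp: D_def)
      finally show "real (N_count (fund_dom_cusp \<nu> T) v i lo hi P X) \<le> F" .
      obtain f\<^sub>0 where f0: "form_eval f\<^sub>0 (of_int \<alpha>) (of_int \<beta>) = 0"
        and reg: "\<And>f. form_size (f - f\<^sub>0) \<le> r0 * \<mu> \<Longrightarrow> f \<in> (\<lambda>g. act g v) ` fund_dom \<nu> \<and>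
          lo * (D * \<mu>^4) \<le> c * \<bar>disc f\<bar> \<and> c * \<bar>disc f\<bar> < hi * (D * \<mu>^4)"
        using region[OF \<mu>] by blast
      let ?S = "{f \<in> (\<lambda>g. act g v) ` fund_dom \<nu> \<inter> V_int_irr i.
        form_eval f (of_int (fst P)) (of_int (snd P)) = 1 \<and> lo * X \<le> \<bar>disc f\<bar> \<and> \<bar>disc f\<bar> < hi * X}"
      have r\<mu>: "r0 * \<mu> = r * R^3" by (simp add: r_def \<mu>_def)
      have "(r0 * \<mu> / (48 * Y))^3 \<le> real (card ?S)"
      proof (rule card_forms_near_ge[OF cop _ \<alpha> \<beta> f0])
        show "1 \<le> Y" using Y by simp
        show "48 * Y \<le> r0 * \<mu>" using YR r\<mu> by simp
        show "finite ?S" by (rule N_count_ge(1)[OF v \<nu>])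
        fix a b c' d
        assume par: "odd a" "even b" "odd c'" "odd d" and ev: "form_eval (a, b, c', d) \<alpha> \<beta> = 1"
          and sz: "form_size (int_form (a, b, c', d) - f\<^sub>0) \<le> r0 * \<mu>"
        let ?f = "int_form (a, b, c', d)"
        note f = reg[OF sz]
        then obtain g where g: "g \<in> fund_dom \<nu>" "?f = act g v" by blast
        have "?f \<in> V_real i" unfolding g(2) by (rule V_real_act[OF vV det_fund_dom[OF g(1)]])
        then have irr: "?f \<in> V_int_irr i" by (rule V_int_irr_intro[OF par])
        have ev': "form_eval ?f (of_int \<alpha>) (of_int \<beta>) = 1" unfolding form_eval_int_form ev by simp
        have "c * (lo * X) \<le> c * \<bar>disc ?f\<bar>" "c * \<bar>disc ?f\<bar> < c * (hi * X)"
          using f unfolding D\<mu> by (simp_all add: mult.left_commute)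
        then have "lo * X \<le> \<bar>disc ?f\<bar>" "\<bar>disc ?f\<bar> < hi * X" using c by simp_all
        then show "?f \<in> ?S" using f irr ev' unfolding \<alpha>\<beta> fst_conv snd_conv by blast
      qed
      also have "\<dots> \<le> real (N_count (fund_dom \<nu>) v i lo hi P X)"
        unfolding of_nat_le_iff by (rule N_count_ge(2)[OF v \<nu>])
      finally show "G \<le> real (N_count (fund_dom \<nu>) v i lo hi P X)"
        unfolding r\<mu> G_def by (simp add: power_divide power_mult_distrib flip: power_mult)
    qed
    have FG: "F / G = K * (1 / \<lfloor>T\<rfloor> + Y / R^2)"
      using r R Y by (simp add: F_def G_def K_def)
    show ?thesis
      unfolding J_count_def FG[symmetric]
      by (intro conjI sum_ratio_le[OF finite_prim_points prim_points_nonempty[OF Y] upper lower G])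
  qed
  then show ?thesis using that[OF K a r] by blast
qed

text \<open>As \<open>x / 0 = 0\<close>, the eventual positivity of the denominator is what makes
  the limit meaningful.\<close>

theorem theorem3:
  fixes \<delta> c_lo c_hi :: real and i :: nat and v :: "real cubic_form"
    and \<nu> :: "real \<Rightarrow> real set" and Y :: "real \<Rightarrow> real"
  assumes "\<delta> > 0"
    and "i \<in> {0, 1}"
    and "0 < c_lo" and "c_lo < c_hi"
    and "gauss_nu \<nu>"
    and "v \<in> V_real i" and "tau v = \<i>"
    and "\<forall>\<^sub>F X in at_top. 2 \<le> Y X \<and> Y X \<le> X powr (1/12 - \<delta>)"
  shows "(\<forall>\<^sub>F X in at_top. J_count (fund_dom \<nu>) v i c_lo c_hi (Y X) X > 0) \<and>
    ((\<lambda>T. Limsup at_top (\<lambda>X. ereal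
        (real (J_count (fund_dom_cusp \<nu> T) v i c_lo c_hi (Y X) X) /
         real (J_count (fund_dom \<nu>) v i c_lo c_hi (Y X) X)))) \<longlongrightarrow> 0) at_top"
proof -
  obtain K a r where K: "K > 0" and a: "a > 0" and r: "r > 0"
    and bound: "\<And>X Y R T. 0 < X \<Longrightarrow> 2 \<le> Y \<Longrightarrow> R = a * X powr (1/12) \<Longrightarrow> Y \<le> R^2 \<Longrightarrow> 48 * Y \<le> r * R^3 \<Longrightarrow> 1 \<le> T \<Longrightarrow>
      0 < J_count (fund_dom \<nu>) v i c_lo c_hi Y X \<and>
      real (J_count (fund_dom_cusp \<nu> T) v i c_lo c_hi Y X) / real (J_count (fund_dom \<nu>) v i c_lo c_hi Y X)
        \<le> K * (1 / \<lfloor>T\<rfloor> + Y / R^2)"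
    using cusp_ratio_bound[OF assms(3-6)] by metis
  define R where "R X = a * X powr (1/12)" for X :: real
  define q where "q T X = real (J_count (fund_dom_cusp \<nu> T) v i c_lo c_hi (Y X) X) /
         real (J_count (fund_dom \<nu>) v i c_lo c_hi (Y X) X)" for T X
  have "filterlim R at_top at_top" unfolding R_def using a by real_asymp
  \<comment> \<open>The three thresholds give in turn \<open>R X \<ge> 1\<close>,
    \<open>Y X \<le> (R X)^2\<close> and \<open>48 * Y X \<le> r * (R X)^3\<close>.\<close>
  then have "\<forall>\<^sub>F X in at_top. R X \<ge> max 1 (max (1 / a) (48 / (a * r)))"
    unfolding filterlim_at_top by blast
  with assms(8) eventually_ge_at_top[of "1::real"]
  have ev: "\<forall>\<^sub>F X in at_top. 0 < J_count (fund_dom \<nu>) v i c_lo c_hi (Y X) X \<and>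
    (\<forall>T\<ge>1. q T X \<le> K * (1 / \<lfloor>T\<rfloor> + 1 / a / R X))"
  proof eventually_elim
    case (elim X)
    then have X: "1 \<le> X" and Y2: "2 \<le> Y X" and R1: "1 \<le> R X" "1 / a \<le> R X" "48 / (a * r) \<le> R X" by auto
    \<comment> \<open>With \<open>\<delta> > 0\<close> this gives \<open>Y X \<le> R X / a\<close>,
      so the error \<open>Y X / (R X)^2\<close> is of order \<open>1 / R X\<close> and disappears in
      the limsup over \<open>X\<close>.\<close>
    have "X powr (1/12 - \<delta>) \<le> X powr (1/12)" using X assms(1) by (intro powr_mono) auto
    then have Y: "Y X \<le> R X / a" using elim a by (simp add: R_def)
    have "R X / a \<le> R X * R X"
      using mult_left_mono[OF R1(2), of "R X"] R1(1) by simp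
    then have YR: "Y X \<le> (R X)^2" using Y by (simp add: power2_eq_square)
    have "48 * (R X / a) = r * R X * (48 / (a * r))" using r by simp
    also have "\<dots> \<le> r * R X * R X" using R1 r by (intro mult_left_mono) auto
    also have "\<dots> \<le> r * R X * R X * R X"
      using R1 r mult_left_mono[OF R1(1), of "r * R X * R X"] by simp
    finally have YR3: "48 * Y X \<le> r * (R X)^3" using Y by (simp add: power3_eq_cube mult.assoc)
    have "Y X / (R X)^2 \<le> (R X / a) / (R X)^2" using Y by (intro divide_right_mono) auto
    also have "\<dots> = 1 / a / R X" using R1 by (simp add: power2_eq_square)
    finally have le: "Y X / (R X)^2 \<le> 1 / a / R X" .
    have X0: "0 < X" using X by simp
    note b = bound[OF X0 Y2 R_def YR YR3]
    have "q T X \<le> K * (1 / \<lfloor>T\<rfloor> + 1 / a / R X)" if "1 \<le> T" for T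
    proof -
      have "q T X \<le> K * (1 / \<lfloor>T\<rfloor> + Y X / (R X)^2)" using b[OF that] unfolding q_def by blast
      also have "\<dots> \<le> K * (1 / \<lfloor>T\<rfloor> + 1 / a / R X)" using le K by (intro mult_left_mono) auto
      finally show ?thesis .
    qed
    then show ?case using b[of 1] by blast
  qed
  have limsup_le: "Limsup at_top (\<lambda>X. ereal (q T X)) \<le> ereal (K * (1 / (T - 1)))" if T: "2 \<le> T" for T
  proof -
    \<comment> \<open>Replacing the floor by \<open>T - 1\<close>, positive as
      \<open>T \<ge> 2\<close>, gives an explicit bound that tends to 0.\<close>
    have "1 / \<lfloor>T\<rfloor> \<le> 1 / (T - 1)" using T by (intro frac_le) linarith+
    have "\<forall>\<^sub>F X in at_top. q T X \<le> K * (1 / (T - 1) + 1 / a / R X)"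
      using ev
    proof eventually_elim
      case (elim X)
      then have "q T X \<le> K * (1 / \<lfloor>T\<rfloor> + 1 / a / R X)" using T by simp
      also have "\<dots> \<le> K * (1 / (T - 1) + 1 / a / R X)"
        using \<open>1 / \<lfloor>T\<rfloor> \<le> 1 / (T - 1)\<close> K by (intro mult_left_mono) auto
      finally show ?case .
    qed
    then have "Limsup at_top (\<lambda>X. ereal (q T X)) \<le> Limsup at_top (\<lambda>X. ereal (K * (1 / (T - 1) + 1 / a / R X)))"
      by (intro Limsup_mono) simp
    also have "\<dots> = ereal (K * (1 / (T - 1) + 0))"
    proof (intro lim_imp_Limsup tendsto_intros)
      show "((\<lambda>X. 1 / a / R X) \<longlongrightarrow> 0) at_top" unfolding R_def using a by real_asymp
    qed simp
    finally show ?thesis by simp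
  qed
  have limsup_ge: "0 \<le> Limsup at_top (\<lambda>X. ereal (q T X))" for T
    by (intro le_Limsup) (auto simp: q_def)
  have "((\<lambda>T. Limsup at_top (\<lambda>X. ereal (q T X))) \<longlongrightarrow> 0) at_top"
  proof (rule tendsto_sandwich[where f = "\<lambda>_. 0"])
    show "\<forall>\<^sub>F T in at_top. 0 \<le> Limsup at_top (\<lambda>X. ereal (q T X))" using limsup_ge by simp
    show "\<forall>\<^sub>F T in at_top. Limsup at_top (\<lambda>X. ereal (q T X)) \<le> ereal (K * (1 / (T - 1)))"
      using eventually_ge_at_top[of 2] by eventually_elim (rule limsup_le)
    have "((\<lambda>T. K * (1 / (T - 1))) \<longlongrightarrow> 0) at_top" by real_asymp
    then show "((\<lambda>T. ereal (K * (1 / (T - 1)))) \<longlongrightarrow> 0) at_top"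
      using tendsto_ereal by (force simp: zero_ereal_def)
  qed simp
  moreover have "\<forall>\<^sub>F X in at_top. 0 < J_count (fund_dom \<nu>) v i c_lo c_hi (Y X) X"
    using ev by eventually_elim blast
  ultimately show ?thesis unfolding q_def by blast
qed

end
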